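(* Let $n\ge 3$ be an integer and let $X_1,X_2,\ldots,X_n$ be independent, identically distributed positive random variables whose common distribution $F$ has a density $f$ that is positive and continuous on $(0,\infty)$. Let $X_{(1)}\le X_{(2)}\le\cdots\le X_{(n)}$ be the order statistics and $\overline{X}_n=\frac1n\sum_{i=1}^n X_i$ the sample mean. Let $p>0$ and $a_{i,j}\ge 0$ $(1\le i,j\le n)$ be real numbers such that $a_{1,n}+a_{n,1}>0$. Define $$Z_n=\sum_{i=1}^n\sum_{j=1}^n a_{i,j}\big|X_{(i)}-X_{(j)}\big|^p.$$ Then $\overline{X}_n$ and $(Z_n)^{1/p}/\overline{X}_n$ are independent if and only if $F$ is a gamma distribution.
   Context: A distribution $F$ is a gamma distribution if, for some $a>0$ and $b>0$, it is absolutely continuous with density $\frac{1}{\Gamma(a)b^a}x^{a-1}e^{-x/b}$ for $x>0$ and $0$ for $x\le 0$. *)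

theory Defs
  imports "HOL-Probability.Probability"
begin

text \<open>The finite family is indexed by \<^term>\<open>{1..n}\<close>, and the rank \<open>k\<close> also runs through
  \<^term>\<open>{1..n}\<close>; \<^const>\<open>sort\<close> is increasing and list positions start at 0.\<close>

definition order_statistic :: "nat \<Rightarrow> (nat \<Rightarrow> 'a \<Rightarrow> real) \<Rightarrow> nat \<Rightarrow> 'a \<Rightarrow> real" where
  "order_statistic n X k \<omega> = sort (map (\<lambda>i. X i \<omega>) [1..<Suc n]) ! (k - 1)"

definition sample_mean :: "nat \<Rightarrow> (nat \<Rightarrow> 'a \<Rightarrow> real) \<Rightarrow> 'a \<Rightarrow> real" where
  "sample_mean n X \<omega> = (\<Sum>i=1..n. X i \<omega>) / real n"

definition spacing_statistic ::
  "nat \<Rightarrow> (nat \<Rightarrow> nat \<Rightarrow> real) \<Rightarrow> real \<Rightarrow> (nat \<Rightarrow> 'a \<Rightarrow> real) \<Rightarrow> 'a \<Rightarrow> real" where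
  "spacing_statistic n a p X \<omega> =
     (\<Sum>i=1..n. \<Sum>j=1..n.
        a i j * \<bar>order_statistic n X i \<omega> - order_statistic n X j \<omega>\<bar> powr p)"

definition gamma_density :: "real \<Rightarrow> real \<Rightarrow> real \<Rightarrow> real" where
  "gamma_density a b x =
     (if x > 0 then 1 / (Gamma a * b powr a) * x powr (a - 1) * exp (- x / b) else 0)"

definition gamma_distribution :: "real measure \<Rightarrow> bool" where
  "gamma_distribution F \<longleftrightarrow>
     (\<exists>a>0. \<exists>b>0. F = density lborel (\<lambda>x. ennreal (gamma_density a b x)))"

end

theory Submission
  imports Defs
begin

text \<open>
  Write \<open>m\<close> for the mean of the sample \<open>x\<close> and \<open>\<tau>\<close> for the \<open>p\<close>-th root of the spacing statistic. Both are
  homogeneous of degree one, so in polar coordinates \<open>x = u * y\<close> with \<open>u = m\<close> the ratio \<open>\<tau> / m\<close> is a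
  function of the direction \<open>y\<close> alone, where \<open>y\<close> has mean one (\<open>nn_integral_polar\<close>). If \<open>f\<close> is the density
  of one observation, the density of \<open>m\<close> on the event that \<open>\<tau> / m\<close> lies in \<open>A\<close> is therefore
  \<open>n * u ^ (n - 1) * J A u\<close>, where \<open>J A u\<close> integrates \<open>\<Prod>i. f (u * y i)\<close> over the directions \<open>y\<close> whose
  ratio lies in \<open>A\<close> (\<open>polar_slices\<close>, \<open>joint_law\<close>).

  If \<open>f s = C * s powr k * exp (\<beta> * s)\<close>, as for a gamma density, then the product equals
  \<open>u powr (k * n) * exp (\<beta> * n * u)\<close> times a function of \<open>y\<close>, since the coordinates of \<open>y\<close> sum to \<open>n\<close>. So
  \<open>J A u\<close> is a function of \<open>u\<close> times a function of \<open>A\<close>, and \<open>m\<close> and \<open>\<tau> / m\<close> are independent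
  (\<open>indep_if_powr_exp\<close>).

  Conversely, let \<open>m\<close> and \<open>\<tau> / m\<close> be independent, and let \<open>J \<epsilon>\<close> belong to the event that \<open>\<tau> / m\<close> is at most a
  fixed multiple of \<open>\<epsilon>\<close>. Since \<open>a 1 n + a n 1 > 0\<close>, the statistic \<open>\<tau>\<close> dominates the range, so all
  coordinates of the directions in this event are within \<open>\<epsilon>\<close> of one. By independence the functions \<open>J \<epsilon>\<close>
  for different \<open>\<epsilon>\<close> are proportional; letting one \<open>\<epsilon>\<close> tend to zero shows \<open>J \<epsilon> s = R \<epsilon> * f s ^ n\<close> for all
  \<open>s\<close>, with \<open>R \<epsilon>\<close> independent of \<open>s\<close> (\<open>prod_integral_proportional\<close>).
  For a smooth \<open>f\<close>, expanding to second order in \<open>\<epsilon>\<close> would give that \<open>s ^ 2\<close> times the second derivative of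
  \<open>ln f\<close> at \<open>s\<close> is constant, whence \<open>ln f\<close> is a combination of \<open>ln s\<close>, \<open>s\<close> and a constant. For a
  continuous \<open>f\<close> the same conclusion follows from a comparison principle. If \<open>ln (f s) - k * ln s\<close> is not
  convex, it is touched from above by a line at some \<open>s\<close>, and there \<open>\<Prod>i. f (s * y i)\<close> is at most
  \<open>f s ^ n\<close> times \<open>\<Prod>i. y i powr k\<close>. So \<open>R \<epsilon>\<close> is at most the integral of that last product, for all small
  \<open>\<epsilon>\<close>; failure of concavity gives the opposite inequality (\<open>prod_integral_compare\<close>). These integrals are
  strictly decreasing in \<open>k\<close>, so whenever \<open>k' < k\<close>, the function for \<open>k\<close> is convex or the one for \<open>k'\<close> is
  concave. At the least \<open>k\<close> with a convex function, the function is also concave, hence affine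
  (\<open>log_coefficient_exists\<close>). Integrability of \<open>f\<close> then restricts the exponents to those of a gamma density
  (\<open>gamma_distribution_if_powr_exp\<close>).
\<close>

section \<open>Convexity and the equation for the logarithm of the density\<close>

text \<open>If the graph rises above one of its chords, then the difference to the chord has a maximum inside the
  interval, and the line parallel to the chord through that point of the graph stays above nearby. This
  replaces a second-derivative test for functions that are only continuous.\<close>

lemma line_touching_from_above_if_not_convex:
  fixes g :: "real \<Rightarrow> real"
  assumes cont: "continuous_on {0<..} g" and "\<not> convex_on {0<..} g"
  obtains s \<delta> \<beta> where "s > 0" "\<delta> > 0" "\<And>t. \<bar>t - s\<bar> \<le> \<delta> \<Longrightarrow> g t \<le> g s + \<beta> * (t - s)"
proof -
  obtain x y \<mu> where xy: "0 < x" "x < y" and \<mu>: "0 < \<mu>" "\<mu> < 1"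
    and above: "g ((1 - \<mu>) * x + \<mu> * y) > (1 - \<mu>) * g x + \<mu> * g y"
    using assms(2) convex_on_linorderI[of "{0<..}" g] by (force simp: not_le)
  define \<beta> where "\<beta> = (g y - g x) / (y - x)"
  define gap where "gap u = g u - g x - \<beta> * (u - x)" for u
  have "continuous_on {x..y} gap"
    unfolding gap_def using xy by (intro continuous_intros continuous_on_subset[OF cont]) auto
  then obtain s where s: "s \<in> {x..y}" "\<And>u. u \<in> {x..y} \<Longrightarrow> gap u \<le> gap s"
    using continuous_attains_sup[of "{x..y}" gap] xy by auto
  define z where "z = (1 - \<mu>) * x + \<mu> * y"
  have zx: "z - x = \<mu> * (y - x)" by (simp add: z_def algebra_simps)
  have "\<mu> * (y - x) > 0" "\<mu> * (y - x) < 1 * (y - x)"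
    using xy \<mu> by (auto intro!: mult_strict_right_mono)
  then have "z \<in> {x..y}" using zx by auto
  moreover have "gap z > 0"
  proof -
    have "\<beta> * (z - x) = \<mu> * (g y - g x)" unfolding zx \<beta>_def using xy by simp
    then show ?thesis using above unfolding gap_def z_def[symmetric] by (simp add: algebra_simps)
  qed
  moreover have "gap x = 0" "gap y = 0" using xy by (auto simp: gap_def \<beta>_def)
  ultimately have "s \<noteq> x" "s \<noteq> y" using s(2)[of z] by auto
  then have sxy: "x < s" "s < y" using s(1) by auto
  show thesis
  proof (rule that[of s "min (s - x) (y - s)" \<beta>])
    fix t assume "\<bar>t - s\<bar> \<le> min (s - x) (y - s)"
    then have "t \<in> {x..y}" by auto
    from s(2)[OF this] show "g t \<le> g s + \<beta> * (t - s)"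
      by (simp add: gap_def algebra_simps)
  qed (use xy sxy in auto)
qed

text \<open>The sum of the \<^term>\<open>ln (y i)\<close> is at most the sum of the \<^term>\<open>y i - 1\<close>, which vanishes, with
  equality only at the constant point. Hence the power \<open>k\<close> of the product is antitone in \<open>k\<close>.\<close>

lemma prod_powr_less_if_mean_1:
  fixes y :: "'i \<Rightarrow> real"
  assumes I: "finite I" and pos: "\<And>i. i \<in> I \<Longrightarrow> y i > 0"
    and mean: "(\<Sum>i\<in>I. y i) = card I" and "k' < k"
  shows "(\<Prod>i\<in>I. y i powr k) \<le> (\<Prod>i\<in>I. y i powr k')"
    and "(\<Prod>i\<in>I. y i powr k) = (\<Prod>i\<in>I. y i powr k') \<Longrightarrow> \<forall>i\<in>I. y i = 1"
proof -
  have ex: "(\<Prod>i\<in>I. y i powr k) = exp (k * (\<Sum>i\<in>I. ln (y i)))" for k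
    unfolding sum_distrib_left exp_sum[OF I]
    by (rule prod.cong) (use pos in \<open>force simp: powr_def\<close>)+
  have nn: "y i - 1 - ln (y i) \<ge> 0" if "i \<in> I" for i
    using ln_le_minus_one[OF pos[OF that]] by simp
  have eq: "(\<Sum>i\<in>I. y i - 1 - ln (y i)) = - (\<Sum>i\<in>I. ln (y i))"
    by (simp add: sum_subtractf mean)
  have "(\<Sum>i\<in>I. ln (y i)) \<le> 0" using sum_nonneg[of I "\<lambda>i. y i - 1 - ln (y i)"] nn eq by simp
  then show "(\<Prod>i\<in>I. y i powr k) \<le> (\<Prod>i\<in>I. y i powr k')"
    unfolding ex using \<open>k' < k\<close> by (simp add: mult_right_mono_neg)
  show "\<forall>i\<in>I. y i = 1" if "(\<Prod>i\<in>I. y i powr k) = (\<Prod>i\<in>I. y i powr k')"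
  proof -
    have "(\<Sum>i\<in>I. ln (y i)) = 0" using that \<open>k' < k\<close> unfolding ex by simp
    then have "\<forall>i\<in>I. y i - 1 - ln (y i) = 0"
      using sum_nonneg_eq_0_iff[OF I, of "\<lambda>i. y i - 1 - ln (y i)"] nn eq by auto
    then show ?thesis using ln_eq_minus_one pos by force
  qed
qed

lemma affine_if_convex_concave:
  fixes g :: "real \<Rightarrow> real"
  assumes cv: "convex_on {0<..} g" and cc: "concave_on {0<..} g"
  obtains \<alpha> \<beta> where "\<And>s. s > 0 \<Longrightarrow> g s = \<alpha> + \<beta> * s"
proof -
  have chord: "(z - x) * g y = (z - y) * g x + (y - x) * g z" if "0 < x" "x < y" "y < z" for x y z
  proof -
    define t where "t = (y - x) / (z - x)"
    have t: "0 \<le> t" "t \<le> 1" and tz: "t * (z - x) = y - x"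
      using that by (auto simp: t_def)
    have y: "(1 - t) * x + t * z = y" using tz by (simp add: algebra_simps)
    have "g y \<le> (1 - t) * g x + t * g z"
      using convex_onD[OF cv t, of x z] that y by simp
    moreover have "g y \<ge> (1 - t) * g x + t * g z"
      using convex_onD[OF cc[unfolded concave_on_def] t, of x z] that y by simp
    ultimately have eq: "g y = (1 - t) * g x + t * g z" by simp
    have "(z - x) * g y = (z - x) * g x + (t * (z - x)) * (g z - g x)"
      unfolding eq by (simp add: algebra_simps)
    then show ?thesis unfolding tz by (simp add: algebra_simps)
  qed
  show thesis
  proof (rule that[of "2 * g 1 - g 2" "g 2 - g 1"])
    fix s :: real assume s: "s > 0"
    consider "s < 1" | "s = 1" | "1 < s" "s < 2" | "s = 2" | "s > 2" by linarith
    then show "g s = 2 * g 1 - g 2 + (g 2 - g 1) * s"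
      by cases (use s chord[of s 1 2] chord[of 1 s 2] chord[of 1 2 s] in \<open>auto simp: algebra_simps\<close>)
  qed
qed

text \<open>Raising \<open>k\<close> makes \<^term>\<open>\<lambda>s. \<phi> s - k * ln s\<close> more convex, so the exponents that give a convex
  function lie above those that give a concave one. Both sets are closed and the hypothesis leaves no gap
  between them; at the common boundary point the function is convex and concave, hence affine.\<close>

lemma log_coefficient_exists:
  fixes \<phi> :: "real \<Rightarrow> real"
  assumes alt: "\<And>k k'. k' < k \<Longrightarrow> convex_on {0<..} (\<lambda>s. \<phi> s - k * ln s) \<or>
                                   concave_on {0<..} (\<lambda>s. \<phi> s - k' * ln s)"
  obtains k \<alpha> \<beta> where "\<And>s. s > 0 \<Longrightarrow> \<phi> s = k * ln s + \<alpha> + \<beta> * s"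
proof -
  define A where "A = {k. convex_on {0<..} (\<lambda>s. \<phi> s - k * ln s)}"
  define B where "B = {k. concave_on {0<..} (\<lambda>s. \<phi> s - k * ln s)}"
  have cl: "closed A" "closed B"
    unfolding A_def B_def concave_on_def convex_on_def
    by (auto intro!: closed_Collect_conj closed_Collect_all closed_Collect_imp closed_Collect_le
          continuous_intros simp: Ball_def)
  have c: "2 * ln 2 - ln 3 > (0::real)"
  proof -
    have "ln (3::real) < ln (2 ^ 2)" by (subst ln_less_cancel_iff) auto
    also have "\<dots> = 2 * ln 2" by (subst ln_realpow) auto
    finally show ?thesis by simp
  qed
  \<comment> \<open>The second difference at 1, 2, 3 of the function with exponent \<open>k\<close> changes sign at \<open>k = \<Delta>\<close>.\<close>
  define \<Delta> where "\<Delta> = (2 * \<phi> 2 - \<phi> 1 - \<phi> 3) / (2 * ln 2 - ln 3)"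
  have B_le: "k \<le> \<Delta>" if "k \<in> B" for k
    using convex_onD[of "{0<..}" "\<lambda>s. - (\<phi> s - k * ln s)" "1/2" 1 3] that c
    by (simp add: B_def concave_on_def \<Delta>_def field_simps)
  have A_ge: "\<Delta> \<le> k" if "k \<in> A" for k
    using convex_onD[of "{0<..}" "\<lambda>s. \<phi> s - k * ln s" "1/2" 1 3] that c
    by (simp add: A_def \<Delta>_def field_simps)
  have "\<Delta> + 1 \<notin> B" using B_le[of "\<Delta> + 1"] by auto
  then have ne: "\<Delta> + 2 \<in> A" using alt[of "\<Delta> + 1" "\<Delta> + 2"] by (auto simp: A_def B_def)
  have bdd: "bdd_below A" using A_ge by (rule bdd_belowI)
  define k where "k = Inf A"
  have "k \<in> A" unfolding k_def using closed_contains_Inf[OF _ bdd cl(1)] ne by auto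
  have "{..<k} \<subseteq> B"
  proof
    fix k' assume "k' \<in> {..<k}"
    then obtain l where l: "k' < l" "l < k" using dense by auto
    then have "l \<notin> A" using cInf_lower[OF _ bdd] unfolding k_def by force
    then show "k' \<in> B" using alt[OF l(1)] by (auto simp: A_def B_def)
  qed
  then have "closure {..<k} \<subseteq> B" by (rule closure_minimal[OF _ cl(2)])
  then have "k \<in> B" by auto
  obtain \<alpha> \<beta> where "\<And>s. s > 0 \<Longrightarrow> \<phi> s - k * ln s = \<alpha> + \<beta> * s"
    using affine_if_convex_concave[of "\<lambda>s. \<phi> s - k * ln s"] \<open>k \<in> A\<close> \<open>k \<in> B\<close>
    unfolding A_def B_def by auto
  then show thesis by (intro that[of k \<alpha> \<beta>]) (simp add: algebra_simps)
qed

section \<open>Products averaged over concentrating measures\<close>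

text \<open>Finite measures of vectors with mean one that concentrate at the constant vector as \<open>\<epsilon>\<close> shrinks,
  without being carried by it. In the application they are Lebesgue measure on vectors \<open>x\<close> whose spread is small
  relative to their mean, and the \<open>Y i\<close> are the coordinates of \<open>x\<close> divided by that mean.\<close>

locale concentrating_measures =
  fixes \<nu> :: "real \<Rightarrow> 'b measure" and Y :: "'i \<Rightarrow> 'b \<Rightarrow> real" and I :: "'i set"
  assumes finite_index: "finite I"
    and finite_measure_nu: "0 < \<epsilon> \<Longrightarrow> finite_measure (\<nu> \<epsilon>)"
    and measurable_Y: "0 < \<epsilon> \<Longrightarrow> i \<in> I \<Longrightarrow> Y i \<in> borel_measurable (\<nu> \<epsilon>)"
    and close: "0 < \<epsilon> \<Longrightarrow> AE y in \<nu> \<epsilon>. \<forall>i\<in>I. \<bar>Y i y - 1\<bar> \<le> \<epsilon>"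
    and mean: "0 < \<epsilon> \<Longrightarrow> AE y in \<nu> \<epsilon>. (\<Sum>i\<in>I. Y i y) = card I"
    and spread: "0 < \<epsilon> \<Longrightarrow> \<not> (AE y in \<nu> \<epsilon>. \<forall>i\<in>I. Y i y = 1)"
begin

text \<open>In that application, for independent observations with density \<open>f\<close>, this is, up to a factor depending only on \<open>s\<close> and the
  dimension, the density at \<open>s\<close> of the mean, restricted to samples with relative spread at most \<open>\<epsilon>\<close>.\<close>

definition prod_integral :: "(real \<Rightarrow> real) \<Rightarrow> real \<Rightarrow> real \<Rightarrow> real" where
  "prod_integral f \<epsilon> s = (\<integral>y. (\<Prod>i\<in>I. f (s * Y i y)) \<partial>\<nu> \<epsilon>)"

lemma close': 
  assumes "0 < \<epsilon>" "\<epsilon> \<le> \<delta>" shows "AE y in \<nu> \<epsilon>. \<forall>i\<in>I. \<bar>Y i y - 1\<bar> \<le> \<delta>"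
  using close[OF assms(1)] by eventually_elim (use assms in force)

text \<open>For \<open>\<epsilon> \<le> 1/2\<close> the coordinates stay away from zero, so \<open>f\<close> is evaluated on a compact set of positive numbers.\<close>

lemma half_bounds:
  assumes "\<forall>i\<in>I. \<bar>Y i y - 1\<bar> \<le> 1/2" "i \<in> I"
  shows "1/2 \<le> Y i y" "Y i y \<le> 3/2"
proof -
  have "\<bar>Y i y - 1\<bar> \<le> 1/2" using assms by blast
  then show "1/2 \<le> Y i y" "Y i y \<le> 3/2" by linarith+
qed

lemma measurable_prod:
  fixes f :: "real \<Rightarrow> real"
  assumes [measurable]: "f \<in> borel_measurable borel" and "0 < \<epsilon>"
  shows "(\<lambda>y. \<Prod>i\<in>I. f (s * Y i y)) \<in> borel_measurable (\<nu> \<epsilon>)"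
proof -
  have [measurable]: "\<And>i. i \<in> I \<Longrightarrow> Y i \<in> borel_measurable (\<nu> \<epsilon>)"
    by (rule measurable_Y[OF \<open>0 < \<epsilon>\<close>])
  have [measurable]: "(\<lambda>y. f (s * Y i y)) \<in> borel_measurable (\<nu> \<epsilon>)" if "i \<in> I" for i
    using that by measurable
  show ?thesis by (rule borel_measurable_prod) measurable
qed

lemma locally_bounded_prod:
  fixes f :: "real \<Rightarrow> real"
  assumes f: "continuous_on {0<..} f" and s: "s > 0"
  obtains B where "\<And>y t. t \<in> {s / 2 .. 2 * s} \<Longrightarrow> (\<forall>i\<in>I. \<bar>Y i y - 1\<bar> \<le> 1/2) \<Longrightarrow> \<bar>(\<Prod>i\<in>I. f (t * Y i y))\<bar> \<le> B"
proof -
  have "compact (f ` {s / 4 .. 3 * s})"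
    using s by (intro compact_continuous_image continuous_on_subset[OF f]) auto
  then obtain B where B: "\<And>u. u \<in> {s / 4 .. 3 * s} \<Longrightarrow> \<bar>f u\<bar> \<le> B"
    by (metis bounded_real compact_imp_bounded imageI)
  show thesis
  proof (rule that[of "B ^ card I"])
    fix y t assume t: "t \<in> {s / 2 .. 2 * s}" and y: "\<forall>i\<in>I. \<bar>Y i y - 1\<bar> \<le> 1/2"
    have "\<bar>f (t * Y i y)\<bar> \<le> B" if "i \<in> I" for i
    proof (rule B)
      note half_bounds[OF y that]
      then have "s/2 * (1/2) \<le> t * Y i y" "t * Y i y \<le> 2 * s * (3 / 2)"
        using t s by (intro mult_mono; auto)+
      then show "t * Y i y \<in> {s / 4 .. 3 * s}" by auto
    qed
    then show "\<bar>(\<Prod>i\<in>I. f (t * Y i y))\<bar> \<le> B ^ card I"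
      unfolding abs_prod by (metis abs_ge_zero prod_constant prod_mono)
  qed
qed

lemma integrable_prod:
  fixes f :: "real \<Rightarrow> real"
  assumes f: "f \<in> borel_measurable borel" "continuous_on {0<..} f"
    and s: "s > 0" and \<epsilon>: "0 < \<epsilon>" "\<epsilon> \<le> 1/2"
  shows "integrable (\<nu> \<epsilon>) (\<lambda>y. \<Prod>i\<in>I. f (s * Y i y))"
proof -
  interpret finite_measure "\<nu> \<epsilon>" by (rule finite_measure_nu[OF \<epsilon>(1)])
  obtain B where B: "\<And>y t. t \<in> {s / 2 .. 2 * s} \<Longrightarrow> (\<forall>i\<in>I. \<bar>Y i y - 1\<bar> \<le> 1/2) \<Longrightarrow> \<bar>(\<Prod>i\<in>I. f (t * Y i y))\<bar> \<le> B"
    using locally_bounded_prod[OF f(2) s] by blast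
  show ?thesis
  proof (rule integrable_const_bound[of _ B])
    show "AE y in \<nu> \<epsilon>. norm (\<Prod>i\<in>I. f (s * Y i y)) \<le> B"
      using close'[OF \<epsilon>] by eventually_elim (use B[of s] s in auto)
  qed (rule measurable_prod[OF f(1) \<epsilon>(1)])
qed

lemma continuous_prod_integral:
  assumes f: "f \<in> borel_measurable borel" "continuous_on {0<..} f"
    and \<epsilon>: "0 < \<epsilon>" "\<epsilon> \<le> 1/2"
  shows "continuous_on {0<..} (prod_integral f \<epsilon>)"
proof -
  interpret finite_measure "\<nu> \<epsilon>" by (rule finite_measure_nu[OF \<epsilon>(1)])
  have "isCont (prod_integral f \<epsilon>) s" if s: "s > 0" for s
  proof -
    obtain B where B: "\<And>y t. t \<in> {s / 2 .. 2 * s} \<Longrightarrow> (\<forall>i\<in>I. \<bar>Y i y - 1\<bar> \<le> 1/2) \<Longrightarrow> \<bar>(\<Prod>i\<in>I. f (t * Y i y))\<bar> \<le> B"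
      using locally_bounded_prod[OF f(2) s] by blast
    have near: "\<forall>\<^sub>F t in at s. t \<in> {s / 2 .. 2 * s}"
      using s by (intro eventually_at_in_open'[THEN eventually_mono, of "{s / 2 <..< 2 * s}"]) auto
    show ?thesis unfolding isCont_def prod_integral_def[abs_def] tendsto_at_iff_sequentially
    proof (intro allI impI)
      fix S :: "nat \<Rightarrow> real" assume S: "\<forall>i. S i \<in> UNIV - {s}" and lim: "S \<longlonglongrightarrow> s"
      have "filterlim S (at s) sequentially" using S lim by (simp add: filterlim_at)
      then have "\<forall>\<^sub>F n in sequentially. S n \<in> {s / 2 .. 2 * s}"
        using near by (auto simp: filterlim_iff)
      then obtain N where N: "\<And>n. n \<ge> N \<Longrightarrow> S n \<in> {s / 2 .. 2 * s}"
        by (auto simp: eventually_sequentially)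
      have "(\<lambda>n. \<integral>y. (\<Prod>i\<in>I. f (S (n + N) * Y i y)) \<partial>\<nu> \<epsilon>) \<longlonglongrightarrow> (\<integral>y. (\<Prod>i\<in>I. f (s * Y i y)) \<partial>\<nu> \<epsilon>)"
      proof (rule integral_dominated_convergence[where w="\<lambda>_. B"])
        show "AE y in \<nu> \<epsilon>. (\<lambda>n. \<Prod>i\<in>I. f (S (n + N) * Y i y)) \<longlonglongrightarrow> (\<Prod>i\<in>I. f (s * Y i y))"
          using close'[OF \<epsilon>]
        proof eventually_elim
          case (elim y)
          have "isCont f (s * Y i y)" if "i \<in> I" for i
          proof -
            note half_bounds[OF elim that]
            then have "s * Y i y > 0" using s by (intro mult_pos_pos) auto
            then show ?thesis using f(2) continuous_on_interior[of "{0<..}" f] by (simp add: interior_open)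
          qed
          then show ?case
            by (intro tendsto_prod isCont_tendsto_compose[of _ f] tendsto_intros LIMSEQ_ignore_initial_segment[OF lim]) auto
        qed
        show "AE y in \<nu> \<epsilon>. norm (\<Prod>i\<in>I. f (S (n + N) * Y i y)) \<le> B" for n
          using close'[OF \<epsilon>] by eventually_elim (use B[OF N[of "n + N"]] in auto)
      qed (use measurable_prod[OF f(1) \<epsilon>(1)] in auto)
      then show "((\<lambda>a. \<integral>y. (\<Prod>i\<in>I. f (a * Y i y)) \<partial>\<nu> \<epsilon>) \<circ> S) \<longlonglongrightarrow> (\<integral>y. (\<Prod>i\<in>I. f (s * Y i y)) \<partial>\<nu> \<epsilon>)"
        unfolding o_def by (rule LIMSEQ_offset)
    qed
  qed
  then show ?thesis by (auto intro: continuous_at_imp_continuous_on)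
qed

lemma prod_integral_pos:
  assumes f: "f \<in> borel_measurable borel" "continuous_on {0<..} f"
    and pos: "\<And>x. x > 0 \<Longrightarrow> f x > 0"
    and s: "s > 0" and \<epsilon>: "0 < \<epsilon>" "\<epsilon> \<le> 1/2"
  shows "prod_integral f \<epsilon> s > 0"
proof -
  have Ppos: "AE y in \<nu> \<epsilon>. (\<Prod>i\<in>I. f (s * Y i y)) > 0"
    using close'[OF \<epsilon>]
  proof eventually_elim
    case (elim y)
    have "s * Y i y > 0" if "i \<in> I" for i
    proof -
      note half_bounds[OF elim that]
      then show "s * Y i y > 0" using s by (intro mult_pos_pos) auto
    qed
    then show ?case by (intro prod_pos pos) auto
  qed
  then have nn: "AE y in \<nu> \<epsilon>. (\<Prod>i\<in>I. f (s * Y i y)) \<ge> 0" by eventually_elim auto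
  have "prod_integral f \<epsilon> s \<noteq> 0"
  proof
    assume "prod_integral f \<epsilon> s = 0"
    then have "AE y in \<nu> \<epsilon>. (\<Prod>i\<in>I. f (s * Y i y)) = 0"
      using integral_nonneg_eq_0_iff_AE[OF integrable_prod[OF f s \<epsilon>] nn]
      unfolding prod_integral_def by simp
    with Ppos have "AE y in \<nu> \<epsilon>. False" by eventually_elim auto
    then have "AE y in \<nu> \<epsilon>. \<forall>i\<in>I. Y i y = 1" by eventually_elim auto
    with spread[OF \<epsilon>(1)] show False by simp
  qed
  moreover have "prod_integral f \<epsilon> s \<ge> 0"
    unfolding prod_integral_def by (rule integral_nonneg_AE[OF nn])
  ultimately show ?thesis by linarith
qed

lemma prod_integral_near_power:
  assumes f: "f \<in> borel_measurable borel" "continuous_on {0<..} f"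
    and pos: "\<And>x. x > 0 \<Longrightarrow> f x > 0"
    and s: "s > 0" and e: "e > 0"
  shows "\<forall>\<^sub>F \<epsilon> in at_right 0. \<bar>prod_integral f \<epsilon> s - f s ^ card I * measure (\<nu> \<epsilon>) (space (\<nu> \<epsilon>))\<bar>
           \<le> e * measure (\<nu> \<epsilon>) (space (\<nu> \<epsilon>))"
proof -
  have "isCont f s" using f(2) s continuous_on_interior[of "{0<..}" f] by (simp add: interior_open)
  have "isCont (\<lambda>v. v ^ card I) (f s)" by (intro continuous_intros)
  then obtain d0 where d0: "d0 > 0" "\<And>v. \<bar>v - f s\<bar> < d0 \<Longrightarrow> \<bar>v ^ card I - f s ^ card I\<bar> < e"
    using e unfolding continuous_at_eps_delta dist_real_def by blast
  define d where "d = min (d0 / 2) (f s)"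
  have d: "d > 0" "d < d0" "d \<le> f s" using d0 pos[OF s] by (auto simp: d_def)
  have close_prod: "\<bar>(\<Prod>i\<in>I. z i) - f s ^ card I\<bar> < e" if "\<And>i. i \<in> I \<Longrightarrow> \<bar>z i - f s\<bar> < d" for z
  proof -
    have z: "f s - d \<le> z i" "z i \<le> f s + d" "0 \<le> z i" if "i \<in> I" for i
      using \<open>\<And>i. i \<in> I \<Longrightarrow> \<bar>z i - f s\<bar> < d\<close>[OF that] d by linarith+
    have "(f s - d) ^ card I \<le> (\<Prod>i\<in>I. z i)"
      using prod_mono[of I "\<lambda>_. f s - d" z] z d by simp
    moreover have "(\<Prod>i\<in>I. z i) \<le> (f s + d) ^ card I"
      using prod_mono[of I z "\<lambda>_. f s + d"] z by simp
    moreover have "\<bar>(f s - d) ^ card I - f s ^ card I\<bar> < e" "\<bar>(f s + d) ^ card I - f s ^ card I\<bar> < e"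
      using d by (auto intro!: d0(2))
    ultimately show ?thesis by linarith
  qed
  obtain h where h: "h > 0" "\<And>u. \<bar>u - s\<bar> < h \<Longrightarrow> \<bar>f u - f s\<bar> < d"
    using \<open>isCont f s\<close> d(1) unfolding continuous_at_eps_delta dist_real_def by blast
  define \<delta> where "\<delta> = min (1/2) (h / (2 * s))"
  have \<delta>: "\<delta> > 0" using h s by (simp add: \<delta>_def)
  have "\<bar>prod_integral f \<epsilon> s - f s ^ card I * measure (\<nu> \<epsilon>) (space (\<nu> \<epsilon>))\<bar>
           \<le> e * measure (\<nu> \<epsilon>) (space (\<nu> \<epsilon>))" if \<epsilon>: "0 < \<epsilon>" "\<epsilon> < \<delta>" for \<epsilon>
  proof -
    interpret finite_measure "\<nu> \<epsilon>" by (rule finite_measure_nu[OF \<epsilon>(1)])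
    have \<epsilon>': "\<epsilon> \<le> 1/2" "\<epsilon> \<le> h / (2 * s)" using \<epsilon> by (auto simp: \<delta>_def)
    have int: "integrable (\<nu> \<epsilon>) (\<lambda>y. (\<Prod>i\<in>I. f (s * Y i y)) - f s ^ card I)"
      using integrable_prod[OF f s \<epsilon>(1) \<epsilon>'(1)] by simp
    have "\<bar>prod_integral f \<epsilon> s - f s ^ card I * measure (\<nu> \<epsilon>) (space (\<nu> \<epsilon>))\<bar>
       = \<bar>\<integral>y. (\<Prod>i\<in>I. f (s * Y i y)) - f s ^ card I \<partial>\<nu> \<epsilon>\<bar>"
      using integrable_prod[OF f s \<epsilon>(1) \<epsilon>'(1)] by (simp add: prod_integral_def mult.commute)
    also have "\<dots> \<le> (\<integral>y. \<bar>(\<Prod>i\<in>I. f (s * Y i y)) - f s ^ card I\<bar> \<partial>\<nu> \<epsilon>)"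
      by (rule integral_abs_bound)
    also have "\<dots> \<le> (\<integral>y. e \<partial>\<nu> \<epsilon>)"
    proof (rule integral_mono_AE)
      show "AE y in \<nu> \<epsilon>. \<bar>(\<Prod>i\<in>I. f (s * Y i y)) - f s ^ card I\<bar> \<le> e"
        using close'[OF \<epsilon>(1) \<epsilon>'(2)]
      proof eventually_elim
        case (elim y)
        have "\<bar>f (s * Y i y) - f s\<bar> < d" if "i \<in> I" for i
        proof (rule h(2))
          have "\<bar>s * Y i y - s\<bar> = s * \<bar>Y i y - 1\<bar>"
            using s by (metis abs_mult abs_of_pos mult.right_neutral right_diff_distrib)
          also have "\<dots> \<le> s * (h / (2 * s))" using elim that s by (intro mult_left_mono) auto
          also have "\<dots> < h" using s h by simp
          finally show "\<bar>s * Y i y - s\<bar> < h" .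
        qed
        then show ?case by (intro less_imp_le close_prod) auto
      qed
    qed (use int in auto)
    also have "\<dots> = e * measure (\<nu> \<epsilon>) (space (\<nu> \<epsilon>))" by simp
    finally show ?thesis .
  qed
  then show ?thesis unfolding eventually_at_right_field using \<delta> by blast
qed


text \<open>By the hypothesis the ratio of the values at \<open>s\<close> and \<open>t\<close> does not depend on \<open>\<epsilon>\<close>. As \<open>\<epsilon>\<close> tends to
  zero all coordinates collapse to the mean, so that the ratio must be the one of
  \<^term>\<open>f s ^ card I\<close> and \<^term>\<open>f t ^ card I\<close>.\<close>

lemma prod_integral_proportional:
  assumes f: "f \<in> borel_measurable borel" "continuous_on {0<..} f"
    and pos: "\<And>x. x > 0 \<Longrightarrow> f x > 0"
    and cross: "\<And>\<epsilon> \<epsilon>'. 0 < \<epsilon> \<Longrightarrow> \<epsilon> \<le> 1/2 \<Longrightarrow> 0 < \<epsilon>' \<Longrightarrow> \<epsilon>' \<le> 1/2 \<Longrightarrow>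
        prod_integral f \<epsilon> s * prod_integral f \<epsilon>' t = prod_integral f \<epsilon> t * prod_integral f \<epsilon>' s"
    and st: "s > 0" "t > 0" and \<epsilon>: "0 < \<epsilon>" "\<epsilon> \<le> 1/2"
  shows "prod_integral f \<epsilon> s * f t ^ card I = prod_integral f \<epsilon> t * f s ^ card I"
proof -
  define V where "V \<epsilon> = measure (\<nu> \<epsilon>) (space (\<nu> \<epsilon>))" for \<epsilon>
  have V: "V \<epsilon> > 0" if "\<epsilon> > 0" for \<epsilon>
  proof -
    interpret finite_measure "\<nu> \<epsilon>" by (rule finite_measure_nu[OF that])
    have "V \<epsilon> \<noteq> 0"
    proof
      assume "V \<epsilon> = 0"
      then have "AE y in \<nu> \<epsilon>. False"
        by (intro AE_I[of _ _ "space (\<nu> \<epsilon>)"]) (auto simp: V_def emeasure_eq_measure)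
      then have "AE y in \<nu> \<epsilon>. \<forall>i\<in>I. Y i y = 1" by eventually_elim auto
      with spread[OF that] show False by simp
    qed
    then show ?thesis by (simp add: V_def zero_less_measure_iff)
  qed
  have "((\<lambda>\<epsilon>. prod_integral f \<epsilon> u / V \<epsilon>) \<longlongrightarrow> f u ^ card I) (at_right 0)" if u: "u > 0" for u
  proof (rule tendstoI)
    fix e :: real assume e: "e > 0"
    have "\<forall>\<^sub>F \<epsilon> in at_right (0::real). 0 < \<epsilon>" by (simp add: eventually_at_right_less)
    moreover have "\<forall>\<^sub>F \<epsilon> in at_right 0. \<bar>prod_integral f \<epsilon> u - f u ^ card I * V \<epsilon>\<bar> \<le> e / 2 * V \<epsilon>"
      unfolding V_def using prod_integral_near_power[OF f pos u, of "e / 2"] e by simp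
    ultimately show "\<forall>\<^sub>F \<epsilon> in at_right 0. dist (prod_integral f \<epsilon> u / V \<epsilon>) (f u ^ card I) < e"
    proof eventually_elim
      case (elim \<epsilon>)
      note V[OF elim(1)]
      have "\<bar>prod_integral f \<epsilon> u / V \<epsilon> - f u ^ card I\<bar> = \<bar>prod_integral f \<epsilon> u - f u ^ card I * V \<epsilon>\<bar> / V \<epsilon>"
      proof -
        have "prod_integral f \<epsilon> u / V \<epsilon> - f u ^ card I = (prod_integral f \<epsilon> u - f u ^ card I * V \<epsilon>) / V \<epsilon>"
          using \<open>V \<epsilon> > 0\<close> by (simp add: diff_divide_distrib)
        then show ?thesis using \<open>V \<epsilon> > 0\<close> by simp
      qed
      also have "\<dots> \<le> e / 2" using elim(2) \<open>V \<epsilon> > 0\<close> by (simp add: divide_le_eq)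
      also have "\<dots> < e" using e by simp
      finally show ?case by (simp add: dist_real_def)
    qed
  qed
  note lim = this
  have "((\<lambda>\<epsilon>'. prod_integral f \<epsilon> s * (prod_integral f \<epsilon>' t / V \<epsilon>')) \<longlongrightarrow> prod_integral f \<epsilon> s * f t ^ card I) (at_right 0)"
    by (intro tendsto_intros lim st)
  moreover have "\<forall>\<^sub>F \<epsilon>' in at_right 0. prod_integral f \<epsilon> s * (prod_integral f \<epsilon>' t / V \<epsilon>')
      = prod_integral f \<epsilon> t * (prod_integral f \<epsilon>' s / V \<epsilon>')"
    unfolding eventually_at_right_field
    by (intro exI[of _ "1/2"]) (use cross[OF \<epsilon>] in auto)
  ultimately have "((\<lambda>\<epsilon>'. prod_integral f \<epsilon> t * (prod_integral f \<epsilon>' s / V \<epsilon>')) \<longlongrightarrow> prod_integral f \<epsilon> s * f t ^ card I) (at_right 0)"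
    by (rule Lim_transform_eventually)
  moreover have "((\<lambda>\<epsilon>'. prod_integral f \<epsilon> t * (prod_integral f \<epsilon>' s / V \<epsilon>')) \<longlongrightarrow> prod_integral f \<epsilon> t * f s ^ card I) (at_right 0)"
    by (intro tendsto_intros lim st)
  ultimately show ?thesis by (intro tendsto_unique[OF trivial_limit_at_right_real])
qed

lemma power_integral_strict_antimono:
  assumes "k' < k" and \<epsilon>: "0 < \<epsilon>" "\<epsilon> \<le> 1/2"
  shows "prod_integral (\<lambda>x. x powr k) \<epsilon> 1 < prod_integral (\<lambda>x. x powr k') \<epsilon> 1"
proof -
  have int: "integrable (\<nu> \<epsilon>) (\<lambda>y. \<Prod>i\<in>I. (1 * Y i y) powr k)" for k
    by (intro integrable_prod \<epsilon>) (auto intro!: continuous_intros)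
  have le: "AE y in \<nu> \<epsilon>. (\<Prod>i\<in>I. (1 * Y i y) powr k) \<le> (\<Prod>i\<in>I. (1 * Y i y) powr k')"
    using close'[OF \<epsilon>] mean[OF \<epsilon>(1)]
  proof eventually_elim
    case (elim y)
    have "Y i y > 0" if "i \<in> I" for i using half_bounds[OF elim(1) that] by linarith
    from prod_powr_less_if_mean_1(1)[OF finite_index this elim(2) \<open>k' < k\<close>] show ?case by simp
  qed
  then have nn: "AE y in \<nu> \<epsilon>. 0 \<le> (\<Prod>i\<in>I. (1 * Y i y) powr k') - (\<Prod>i\<in>I. (1 * Y i y) powr k)"
    by eventually_elim simp
  have "prod_integral (\<lambda>x. x powr k) \<epsilon> 1 \<noteq> prod_integral (\<lambda>x. x powr k') \<epsilon> 1"
  proof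
    assume "prod_integral (\<lambda>x. x powr k) \<epsilon> 1 = prod_integral (\<lambda>x. x powr k') \<epsilon> 1"
    then have "(\<integral>y. (\<Prod>i\<in>I. (1 * Y i y) powr k') - (\<Prod>i\<in>I. (1 * Y i y) powr k) \<partial>\<nu> \<epsilon>) = 0"
      unfolding prod_integral_def using int by simp
    then have "AE y in \<nu> \<epsilon>. (\<Prod>i\<in>I. (1 * Y i y) powr k') - (\<Prod>i\<in>I. (1 * Y i y) powr k) = 0"
      using integral_nonneg_eq_0_iff_AE[OF _ nn] int by simp
    then have "AE y in \<nu> \<epsilon>. \<forall>i\<in>I. Y i y = 1"
      using close'[OF \<epsilon>] mean[OF \<epsilon>(1)]
    proof eventually_elim
      case (elim y)
      have "Y i y > 0" if "i \<in> I" for i using half_bounds[OF elim(2) that] by linarith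
      moreover have "(\<Prod>i\<in>I. Y i y powr k) = (\<Prod>i\<in>I. Y i y powr k')" using elim(1) by simp
      ultimately show ?case
        by (intro prod_powr_less_if_mean_1(2)[OF finite_index _ elim(3) \<open>k' < k\<close>])
    qed
    with spread[OF \<epsilon>(1)] show False by simp
  qed
  moreover have "prod_integral (\<lambda>x. x powr k) \<epsilon> 1 \<le> prod_integral (\<lambda>x. x powr k') \<epsilon> 1"
    unfolding prod_integral_def by (rule integral_mono_AE[OF int int le])
  ultimately show ?thesis by simp
qed

text \<open>At a touching point \<open>s\<close>, the linear terms of the touching line cancel because the coordinates have mean
  one, so the product of the \<open>f (s * Y i y)\<close> is bounded by the product of the powers \<open>Y i y powr k\<close>.
  The sign \<open>\<sigma>\<close> treats failure of convexity (\<open>\<sigma> = 1\<close>) and of concavity (\<open>\<sigma> = -1\<close>) together.\<close>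

lemma prod_integral_compare:
  fixes f :: "real \<Rightarrow> real" and \<sigma> :: real
  assumes f: "f \<in> borel_measurable borel" "continuous_on {0<..} f"
    and pos: "\<And>x. x > 0 \<Longrightarrow> f x > 0"
    and nconv: "\<not> convex_on {0<..} (\<lambda>s. \<sigma> * (ln (f s) - k * ln s))"
  shows "\<exists>\<delta> s. 0 < \<delta> \<and> 0 < s \<and> (\<forall>\<epsilon>. 0 < \<epsilon> \<longrightarrow> \<epsilon> \<le> 1/2 \<longrightarrow> \<epsilon> \<le> \<delta> \<longrightarrow>
           \<sigma> * prod_integral f \<epsilon> s \<le> \<sigma> * (f s ^ card I * prod_integral (\<lambda>x. x powr k) \<epsilon> 1))"
proof -
  define g where "g s = ln (f s) - k * ln s" for s
  have "\<forall>s\<in>{0<..}. f s \<noteq> 0" using pos by force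
  then have cont: "continuous_on {0<..} (\<lambda>s. \<sigma> * g s)"
    unfolding g_def using f(2) by (intro continuous_intros) auto
  obtain s \<delta> \<beta> where s: "s > 0" "\<delta> > 0"
    and touch: "\<And>t. \<bar>t - s\<bar> \<le> \<delta> \<Longrightarrow> \<sigma> * g t \<le> \<sigma> * g s + \<beta> * (t - s)"
    by (rule line_touching_from_above_if_not_convex[OF cont nconv[folded g_def]], rule that)
  have "\<sigma> * prod_integral f \<epsilon> s \<le> \<sigma> * (f s ^ card I * prod_integral (\<lambda>x. x powr k) \<epsilon> 1)"
    if \<epsilon>: "0 < \<epsilon>" "\<epsilon> \<le> 1/2" "\<epsilon> \<le> \<delta> / s" for \<epsilon>
  proof -
    have int: "integrable (\<nu> \<epsilon>) (\<lambda>y. \<Prod>i\<in>I. (1 * Y i y) powr k)"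
      by (intro integrable_prod \<epsilon>) (auto intro!: continuous_intros)
    have "(\<integral>y. \<sigma> * (\<Prod>i\<in>I. f (s * Y i y)) \<partial>\<nu> \<epsilon>)
       \<le> (\<integral>y. \<sigma> * (f s ^ card I * (\<Prod>i\<in>I. (1 * Y i y) powr k)) \<partial>\<nu> \<epsilon>)"
    proof (rule integral_mono_AE)
      show "AE y in \<nu> \<epsilon>. \<sigma> * (\<Prod>i\<in>I. f (s * Y i y)) \<le> \<sigma> * (f s ^ card I * (\<Prod>i\<in>I. (1 * Y i y) powr k))"
        using close'[OF \<epsilon>(1,2)] close'[OF \<epsilon>(1,3)] mean[OF \<epsilon>(1)]
      proof eventually_elim
        case (elim y)
        \<comment> \<open>The logarithm of the quotient of the two products.\<close>
        define L where "L = (\<Sum>i\<in>I. g (s * Y i y) - g s)"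
        have Y: "Y i y > 0" if "i \<in> I" for i using half_bounds[OF elim(1) that] by linarith
        have "\<sigma> * (g (s * Y i y) - g s) \<le> \<beta> * s * (Y i y - 1)" if "i \<in> I" for i
        proof -
          have "\<bar>s * Y i y - s\<bar> = s * \<bar>Y i y - 1\<bar>"
            using s by (metis abs_mult abs_of_pos mult.right_neutral right_diff_distrib)
          also have "\<dots> \<le> s * (\<delta> / s)" using elim(2) that s by (intro mult_left_mono) auto
          also have "\<dots> = \<delta>" using s by simp
          finally show ?thesis using touch[of "s * Y i y"] by (simp add: algebra_simps)
        qed
        then have "\<sigma> * L \<le> (\<Sum>i\<in>I. \<beta> * s * (Y i y - 1))"
          unfolding L_def sum_distrib_left by (rule sum_mono)
        also have "\<dots> = 0" by (simp add: sum_distrib_left[symmetric] sum_subtractf elim(3))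
        finally have L: "\<sigma> * L \<le> 0" .
        have "f (s * Y i y) = f s * Y i y powr k * exp (g (s * Y i y) - g s)" if "i \<in> I" for i
          using s Y[OF that] pos[OF s(1)] pos[of "s * Y i y"]
          by (simp add: g_def exp_diff exp_add powr_def ln_mult algebra_simps)
        then have "(\<Prod>i\<in>I. f (s * Y i y)) = f s ^ card I * (\<Prod>i\<in>I. (1 * Y i y) powr k) * exp L"
          by (simp add: L_def prod.distrib exp_sum[OF finite_index])
        moreover have "\<sigma> * (exp L - 1) \<le> 0"
          using L by (auto simp: mult_le_0_iff)
        moreover have "0 \<le> f s ^ card I * (\<Prod>i\<in>I. (1 * Y i y) powr k)"
          using pos[OF s(1)] by (intro mult_nonneg_nonneg prod_nonneg) auto
        ultimately show ?case
          using mult_nonpos_nonneg[of "\<sigma> * (exp L - 1)" "f s ^ card I * (\<Prod>i\<in>I. (1 * Y i y) powr k)"]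
          by (simp add: algebra_simps)
      qed
    qed (use int integrable_prod[OF f s(1) \<epsilon>(1,2)] in auto)
    then show ?thesis by (simp add: prod_integral_def)
  qed
  then show ?thesis using s by (intro exI[of _ "\<delta> / s"] exI[of _ s]) auto
qed

text \<open>If \<^term>\<open>\<lambda>s. ln (f s) - k * ln s\<close> is not convex and \<^term>\<open>\<lambda>s. ln (f s) - k' * ln s\<close> is not
  concave for some \<open>k' < k\<close>, then for small \<open>\<epsilon>\<close> the two comparisons squeeze the constant \<open>R \<epsilon>\<close> below the
  integral for \<open>k\<close> and above the one for \<open>k'\<close>, against the strict monotonicity of these integrals in
  the exponent.\<close>

lemma powr_exp_if_proportional:
  assumes f: "f \<in> borel_measurable borel" "continuous_on {0<..} f"
    and pos: "\<And>x. x > 0 \<Longrightarrow> f x > 0"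
    and cross: "\<And>\<epsilon> \<epsilon>' s t. 0 < \<epsilon> \<Longrightarrow> \<epsilon> \<le> 1/2 \<Longrightarrow> 0 < \<epsilon>' \<Longrightarrow> \<epsilon>' \<le> 1/2 \<Longrightarrow> 0 < s \<Longrightarrow> 0 < t \<Longrightarrow>
        prod_integral f \<epsilon> s * prod_integral f \<epsilon>' t = prod_integral f \<epsilon> t * prod_integral f \<epsilon>' s"
  obtains k C \<beta> where "C > 0" "\<And>s. s > 0 \<Longrightarrow> f s = C * s powr k * exp (\<beta> * s)"
proof -
  define R where "R \<epsilon> = prod_integral f \<epsilon> 1 / f 1 ^ card I" for \<epsilon>
  have R: "prod_integral f \<epsilon> s = f s ^ card I * R \<epsilon>" if "0 < \<epsilon>" "\<epsilon> \<le> 1/2" "0 < s" for \<epsilon> s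
    using prod_integral_proportional[OF f pos cross, of s 1 \<epsilon>] that pos[of 1]
    by (simp add: R_def field_simps)
  have "convex_on {0<..} (\<lambda>s. ln (f s) - k * ln s) \<or> concave_on {0<..} (\<lambda>s. ln (f s) - k' * ln s)"
    if "k' < k" for k k'
  proof (rule ccontr)
    assume *: "\<not> ?thesis"
    from prod_integral_compare[OF f pos, of 1 k] *
    obtain \<delta> s where 1: "0 < \<delta>" "0 < s" "\<And>\<epsilon>. 0 < \<epsilon> \<Longrightarrow> \<epsilon> \<le> 1/2 \<Longrightarrow> \<epsilon> \<le> \<delta> \<Longrightarrow>
      prod_integral f \<epsilon> s \<le> f s ^ card I * prod_integral (\<lambda>x. x powr k) \<epsilon> 1" by auto
    from prod_integral_compare[OF f pos, of "-1" k'] *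
    obtain \<delta>' s' where 2: "0 < \<delta>'" "0 < s'" "\<And>\<epsilon>. 0 < \<epsilon> \<Longrightarrow> \<epsilon> \<le> 1/2 \<Longrightarrow> \<epsilon> \<le> \<delta>' \<Longrightarrow>
      f s' ^ card I * prod_integral (\<lambda>x. x powr k') \<epsilon> 1 \<le> prod_integral f \<epsilon> s'"
      by (auto simp: concave_on_def)
    define \<epsilon> where "\<epsilon> = min (1/2) (min \<delta> \<delta>')"
    have \<epsilon>: "0 < \<epsilon>" "\<epsilon> \<le> 1/2" "\<epsilon> \<le> \<delta>" "\<epsilon> \<le> \<delta>'" using 1 2 by (auto simp: \<epsilon>_def)
    have "R \<epsilon> \<le> prod_integral (\<lambda>x. x powr k) \<epsilon> 1"
      using 1(3)[OF \<epsilon>(1-3)] pos[OF 1(2)] unfolding R[OF \<epsilon>(1,2) 1(2)] by simp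
    also have "\<dots> < prod_integral (\<lambda>x. x powr k') \<epsilon> 1"
      by (rule power_integral_strict_antimono[OF that \<epsilon>(1,2)])
    also have "\<dots> \<le> R \<epsilon>"
      using 2(3)[OF \<epsilon>(1,2,4)] pos[OF 2(2)] unfolding R[OF \<epsilon>(1,2) 2(2)] by simp
    finally show False by simp
  qed
  then obtain k \<alpha> \<beta> where k: "\<And>s. s > 0 \<Longrightarrow> ln (f s) = k * ln s + \<alpha> + \<beta> * s"
    using log_coefficient_exists[of "\<lambda>s. ln (f s)"] by metis
  show thesis
  proof (rule that[of "exp \<alpha>" k \<beta>])
    fix s :: real assume s: "s > 0"
    have "f s = exp (ln (f s))" using pos[OF s] by simp
    also have "\<dots> = exp \<alpha> * s powr k * exp (\<beta> * s)"
      unfolding k[OF s] using s by (simp add: powr_def exp_add algebra_simps)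
    finally show "f s = exp \<alpha> * s powr k * exp (\<beta> * s)" .
  qed simp
qed

end

section \<open>Polar coordinates for a homogeneous function\<close>

lemma measurable_component_PiM_lborel:
  "i \<in> I \<Longrightarrow> (\<lambda>x. x i) \<in> borel_measurable (PiM I (\<lambda>_. lborel :: real measure))"
  using measurable_component_singleton[of i I "\<lambda>_. lborel :: real measure"] by simp

lemma measurable_restrict_PiM_lborel:
  fixes f :: "'i \<Rightarrow> 'a \<Rightarrow> real"
  assumes "\<And>i. i \<in> I \<Longrightarrow> f i \<in> borel_measurable N"
  shows "(\<lambda>x. \<lambda>i\<in>I. f i x) \<in> measurable N (PiM I (\<lambda>_. lborel))"
  by (rule measurable_restrict) (use assms in simp)

lemma PiM_lborel_scale:
  fixes c :: real
  assumes I: "finite I" and c: "c > 0"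
  defines "\<mu> \<equiv> PiM I (\<lambda>_. lborel :: real measure)"
  shows "density (distr \<mu> \<mu> (\<lambda>x. \<lambda>i\<in>I. c * x i)) (\<lambda>_. ennreal (c ^ card I)) = \<mu>"
proof -
  interpret product_sigma_finite "\<lambda>_. lborel :: real measure" by standard
  have sc: "(\<lambda>x. \<lambda>i\<in>I. c * x i) \<in> measurable \<mu> \<mu>"
    unfolding \<mu>_def by (intro measurable_restrict_PiM_lborel borel_measurable_times borel_measurable_const
        measurable_component_PiM_lborel)
  show ?thesis unfolding \<mu>_def
  proof (rule PiM_eqI[OF I], simp)
    fix A :: "'a \<Rightarrow> real set" assume A: "\<And>i. i \<in> I \<Longrightarrow> A i \<in> sets lborel"
    have one: "emeasure lborel (A i) = ennreal c * emeasure lborel ((*) c -` A i)" if "i \<in> I" for i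
    proof -
      have Ai: "A i \<in> sets borel" using A[OF that] by simp
      have "emeasure lborel (A i) = emeasure (density (distr lborel borel ((*) c)) (\<lambda>_. ennreal \<bar>c\<bar>)) (A i)"
        using lborel_distr_mult'[of c] c by simp
      also have "\<dots> = ennreal c * emeasure lborel ((*) c -` A i)"
        using Ai c by (simp add: emeasure_density_const emeasure_distr)
      finally show ?thesis .
    qed
    have pre: "(\<lambda>x. \<lambda>i\<in>I. c * x i) -` (Pi\<^sub>E I A) \<inter> space (PiM I (\<lambda>_. lborel))
        = Pi\<^sub>E I (\<lambda>i. (*) c -` A i)"
      by (auto simp: space_PiM PiE_iff extensional_def)
    have preA: "(*) c -` A i \<in> sets lborel" if "i \<in> I" for i
      using measurable_sets[of "(*) c" borel borel "A i"] A[OF that] by simp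
    have PA: "Pi\<^sub>E I A \<in> sets (PiM I (\<lambda>_. lborel))" using A I by (intro sets_PiM_I_finite) auto
    have "emeasure (density (distr (PiM I (\<lambda>_. lborel)) (PiM I (\<lambda>_. lborel)) (\<lambda>x. \<lambda>i\<in>I. c * x i))
            (\<lambda>_. ennreal (c ^ card I))) (Pi\<^sub>E I A)
        = ennreal (c ^ card I) * emeasure (PiM I (\<lambda>_. lborel)) (Pi\<^sub>E I (\<lambda>i. (*) c -` A i))"
      using PA sc unfolding pre[symmetric] \<mu>_def by (simp add: emeasure_density_const emeasure_distr)
    also have "\<dots> = (\<Prod>i\<in>I. ennreal c) * (\<Prod>i\<in>I. emeasure lborel ((*) c -` A i))"
      using c I preA by (simp add: emeasure_PiM ennreal_power)
    also have "\<dots> = (\<Prod>i\<in>I. emeasure lborel (A i))"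
      unfolding prod.distrib[symmetric] by (rule prod.cong) (simp_all add: one)
    finally show "emeasure (density (distr (PiM I (\<lambda>_. lborel)) (PiM I (\<lambda>_. lborel)) (\<lambda>x. \<lambda>i\<in>I. c * x i))
            (\<lambda>_. ennreal (c ^ card I))) (Pi\<^sub>E I A) = (\<Prod>i\<in>I. emeasure lborel (A i))" .
  qed
qed

lemma nn_integral_PiM_lborel_scale:
  fixes c :: real
  assumes I: "finite I" and c: "c > 0"
    and f: "f \<in> borel_measurable (PiM I (\<lambda>_. lborel))"
  shows "(\<integral>\<^sup>+x. f (\<lambda>i\<in>I. c * x i) \<partial>PiM I (\<lambda>_. lborel))
       = ennreal (1 / c ^ card I) * (\<integral>\<^sup>+x. f x \<partial>PiM I (\<lambda>_. lborel))"
proof -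
  define \<mu> where "\<mu> = PiM I (\<lambda>_. lborel :: real measure)"
  have sc[measurable]: "(\<lambda>x. \<lambda>i\<in>I. c * x i) \<in> measurable \<mu> \<mu>"
    unfolding \<mu>_def by (intro measurable_restrict_PiM_lborel borel_measurable_times borel_measurable_const
        measurable_component_PiM_lborel)
  have [measurable]: "f \<in> borel_measurable \<mu>" using f by (simp add: \<mu>_def)
  have "(\<integral>\<^sup>+x. f x \<partial>\<mu>) = (\<integral>\<^sup>+x. f x \<partial>density (distr \<mu> \<mu> (\<lambda>x. \<lambda>i\<in>I. c * x i)) (\<lambda>_. ennreal (c ^ card I)))"
    using PiM_lborel_scale[OF I c] by (simp add: \<mu>_def)
  also have "\<dots> = ennreal (c ^ card I) * (\<integral>\<^sup>+x. f (\<lambda>i\<in>I. c * x i) \<partial>\<mu>)"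
    by (simp add: nn_integral_density nn_integral_cmult nn_integral_distr)
  finally have "ennreal (1 / c ^ card I) * (\<integral>\<^sup>+x. f x \<partial>\<mu>)
      = (ennreal (1 / c ^ card I) * ennreal (c ^ card I)) * (\<integral>\<^sup>+x. f (\<lambda>i\<in>I. c * x i) \<partial>\<mu>)"
    by (simp add: mult.assoc)
  also have "ennreal (1 / c ^ card I) * ennreal (c ^ card I) = 1"
    using c by (simp add: ennreal_mult[symmetric])
  finally show ?thesis unfolding \<mu>_def by (simp only: mult_1)
qed

lemma PiM_density:
  fixes f :: "real \<Rightarrow> ennreal"
  assumes I: "finite I" and f[measurable]: "f \<in> borel_measurable borel"
    and sf: "sigma_finite_measure (density lborel f)"
  shows "PiM I (\<lambda>_. density lborel f) = density (PiM I (\<lambda>_. lborel)) (\<lambda>x. \<Prod>i\<in>I. f (x i))"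
proof -
  interpret L: product_sigma_finite "\<lambda>_. lborel :: real measure" by standard
  interpret D: product_sigma_finite "\<lambda>_. density lborel f" using sf by (simp add: product_sigma_finite_def)
  have [measurable]: "(\<lambda>x. \<Prod>i\<in>I. f (x i)) \<in> borel_measurable (PiM I (\<lambda>_. lborel))"
    by (intro borel_measurable_prod_ennreal measurable_compose[OF measurable_component_PiM_lborel f])
  show ?thesis
  proof (rule D.PiM_eqI[OF I, symmetric])
    show "sets (density (PiM I (\<lambda>_. lborel)) (\<lambda>x. \<Prod>i\<in>I. f (x i))) = sets (PiM I (\<lambda>_. density lborel f))"
      by (simp cong: sets_PiM_cong)
    fix A assume A: "\<And>i. i \<in> I \<Longrightarrow> A i \<in> sets (density lborel f)"
    have PA: "Pi\<^sub>E I A \<in> sets (PiM I (\<lambda>_. lborel))" using A I by (intro sets_PiM_I_finite) auto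
    have "emeasure (density (PiM I (\<lambda>_. lborel)) (\<lambda>x. \<Prod>i\<in>I. f (x i))) (Pi\<^sub>E I A)
        = (\<integral>\<^sup>+x. (\<Prod>i\<in>I. f (x i)) * indicator (Pi\<^sub>E I A) x \<partial>PiM I (\<lambda>_. lborel))"
      using PA by (simp add: emeasure_density)
    also have "\<dots> = (\<integral>\<^sup>+x. (\<Prod>i\<in>I. f (x i) * indicator (A i) (x i)) \<partial>PiM I (\<lambda>_. lborel))"
    proof (rule nn_integral_cong)
      fix x :: "'a \<Rightarrow> real" assume "x \<in> space (PiM I (\<lambda>_. lborel))"
      then have ext: "x \<in> extensional I" by (simp add: space_PiM PiE_def)
      have "indicator (Pi\<^sub>E I A) x = (\<Prod>i\<in>I. indicator (A i) (x i) :: ennreal)"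
      proof (cases "\<forall>i\<in>I. x i \<in> A i")
        case True
        then show ?thesis using ext by (simp add: PiE_def Pi_def)
      next
        case False
        then show ?thesis using I by (auto simp: PiE_def Pi_def indicator_def prod_zero_iff)
      qed
      then show "(\<Prod>i\<in>I. f (x i)) * indicator (Pi\<^sub>E I A) x = (\<Prod>i\<in>I. f (x i) * indicator (A i) (x i))"
        by (simp add: prod.distrib)
    qed
    also have "\<dots> = (\<Prod>i\<in>I. \<integral>\<^sup>+y. f y * indicator (A i) y \<partial>lborel)"
      using A by (intro L.product_nn_integral_prod[OF I, where f="\<lambda>i y. f y * indicator (A i) y"]) auto
    also have "\<dots> = (\<Prod>i\<in>I. emeasure (density lborel f) (A i))"
      using A by (intro prod.cong) (auto simp: emeasure_density)
    finally show "emeasure (density (PiM I (\<lambda>_. lborel)) (\<lambda>x. \<Prod>i\<in>I. f (x i))) (Pi\<^sub>E I A)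
        = (\<Prod>i\<in>I. emeasure (density lborel f) (A i))" .
  qed
qed

lemma nn_integral_inverse_power_tail:
  fixes r :: real
  assumes "r > 0" "n > 0"
  shows "(\<integral>\<^sup>+t. ennreal (real n / t ^ Suc n) * indicator {r..} t \<partial>lborel) = ennreal (1 / r ^ n)"
proof -
  have "(\<integral>\<^sup>+t. ennreal (real n / t ^ Suc n) * indicator {r..} t \<partial>lborel) = ennreal (0 - (- (1 / r ^ n)))"
  proof (rule nn_integral_FTC_atLeast[where F="\<lambda>t. - (1 / t ^ n)"])
    fix x assume "r \<le> x"
    then have "x > 0" using assms by simp
    then show "((\<lambda>t. - (1 / t ^ n)) has_real_derivative real n / x ^ Suc n) (at x)"
      using assms by (auto intro!: derivative_eq_intros simp: field_simps power_add[symmetric] power_diff)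
    show "0 \<le> real n / x ^ Suc n" using \<open>x > 0\<close> by simp
  next
    have "((\<lambda>t::real. inverse (t ^ n)) \<longlongrightarrow> 0) at_top"
      by (intro tendsto_inverse_0_at_top filterlim_pow_at_top filterlim_ident) (use assms in auto)
    then show "((\<lambda>t::real. - (1 / t ^ n)) \<longlongrightarrow> 0) at_top"
      using tendsto_minus by (fastforce simp: inverse_eq_divide)
  qed measurable
  then show ?thesis by simp
qed

text \<open>Polar coordinates with the homogeneous function \<open>\<rho>\<close> as radius \<open>u\<close> and \<open>x / \<rho> x\<close> as direction. Directions
  are integrated by averaging over the part of the cone where \<open>\<rho>\<close> is below one, which avoids any surface
  measure. Rescaling the radius in the inner integral, and then the point itself, moves this truncation
  into an integral over the radius, which is elementary.\<close>

lemma nn_integral_polar: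
  fixes \<rho> :: "('i \<Rightarrow> real) \<Rightarrow> real" and H :: "('i \<Rightarrow> real) \<Rightarrow> ennreal"
  defines "\<mu> \<equiv> \<lambda>I. PiM I (\<lambda>_. lborel :: real measure)"
  assumes I: "finite I" "I \<noteq> {}"
    and meas: "\<rho> \<in> borel_measurable (\<mu> I)" "H \<in> borel_measurable (\<mu> I)" "K \<in> sets (\<mu> I)"
    and cone: "\<And>x t. x \<in> space (\<mu> I) \<Longrightarrow> t > 0 \<Longrightarrow> (\<lambda>i\<in>I. t * x i) \<in> K \<longleftrightarrow> x \<in> K"
    and pos: "\<And>x. x \<in> K \<Longrightarrow> \<rho> x > 0"
    and hom: "\<And>x t. x \<in> K \<Longrightarrow> t > 0 \<Longrightarrow> \<rho> (\<lambda>i\<in>I. t * x i) = t * \<rho> x"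
  shows "(\<integral>\<^sup>+x. H x * indicator K x \<partial>\<mu> I)
    = (\<integral>\<^sup>+u. (\<integral>\<^sup>+x. H (\<lambda>i\<in>I. u * x i / \<rho> x) * indicator {x\<in>K. \<rho> x < 1} x \<partial>\<mu> I)
          * (ennreal (card I * u ^ (card I - 1)) * indicator {0<..} u) \<partial>lborel)"
proof -
  define n where "n = card I"
  have n: "n > 0" using I by (simp add: n_def card_gt_0_iff)
  define m where "m = \<mu> I"
  interpret product_sigma_finite "\<lambda>_. lborel :: real measure" by standard
  interpret M: sigma_finite_measure m unfolding m_def \<mu>_def by (rule sigma_finite[OF I(1)])
  interpret P: pair_sigma_finite m lborel
    by (intro pair_sigma_finite.intro M.sigma_finite_measure_axioms lborel.sigma_finite_measure_axioms)
  have rHK: "\<rho> \<in> borel_measurable m" "H \<in> borel_measurable m" "K \<in> sets m"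
    unfolding m_def by (rule meas)+
  note [measurable] = rHK
  have comp: "(\<lambda>x. x i) \<in> borel_measurable m" if "i \<in> I" for i
    unfolding m_def \<mu>_def using that by (rule measurable_component_PiM_lborel)
  have K_sub: "x \<in> space m" if "x \<in> K" for x using sets.sets_into_space[of K m] that by auto
  define c where "c = (\<lambda>u::real. ennreal (n * u ^ (n - 1)) * indicator {0<..} u)"
  have c[measurable]: "c \<in> borel_measurable borel" unfolding c_def by measurable
  define K1 where "K1 = {x\<in>K. \<rho> x < 1}"
  have "K1 = {x\<in>space m. \<rho> x < 1} \<inter> K" unfolding K1_def using K_sub by blast
  moreover have "{x\<in>space m. \<rho> x < 1} \<in> sets m"
    by (rule borel_measurable_less[OF rHK(1) borel_measurable_const])
  ultimately have K1_sets[measurable]: "K1 \<in> sets m" using rHK(3) by simp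
  have comp2: "(\<lambda>p. fst p i) \<in> borel_measurable (m \<Otimes>\<^sub>M (lborel :: real measure))" if "i \<in> I" for i
    by (rule measurable_compose[OF measurable_fst comp[OF that]])
  have rho2: "(\<lambda>p. \<rho> (fst p)) \<in> borel_measurable (m \<Otimes>\<^sub>M (lborel :: real measure))"
    by (rule measurable_compose[OF measurable_fst rHK(1)])
  have snd2: "snd \<in> borel_measurable (m \<Otimes>\<^sub>M (lborel :: real measure))"
    using measurable_snd[of m "lborel :: real measure"] by simp
  have "(\<lambda>p. \<lambda>i\<in>I. snd p * fst p i / \<rho> (fst p)) \<in> measurable (m \<Otimes>\<^sub>M lborel) (PiM I (\<lambda>_. lborel))"
    by (intro measurable_restrict_PiM_lborel borel_measurable_divide borel_measurable_times comp2 rho2 snd2)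
  then have sc1: "(\<lambda>p. \<lambda>i\<in>I. snd p * fst p i / \<rho> (fst p)) \<in> measurable (m \<Otimes>\<^sub>M lborel) m"
    unfolding m_def \<mu>_def .
  have "(\<lambda>p. \<lambda>i\<in>I. snd p * fst p i) \<in> measurable (m \<Otimes>\<^sub>M lborel) (PiM I (\<lambda>_. lborel))"
    by (intro measurable_restrict_PiM_lborel borel_measurable_times comp2 snd2)
  then have sc2: "(\<lambda>p. \<lambda>i\<in>I. snd p * fst p i) \<in> measurable (m \<Otimes>\<^sub>M lborel) m"
    unfolding m_def \<mu>_def .
  note [measurable] = measurable_compose[OF sc1 rHK(2)] measurable_compose[OF sc2 rHK(2)]
  have m1: "(\<lambda>(x, u). H (\<lambda>i\<in>I. u * x i / \<rho> x) * indicator K1 x * c u) \<in> borel_measurable (m \<Otimes>\<^sub>M lborel)"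
    unfolding split_beta' by measurable
  have m2: "(\<lambda>(x, t). ennreal (\<rho> x ^ n) * indicator K1 x * H (\<lambda>i\<in>I. t * x i) * c t) \<in> borel_measurable (m \<Otimes>\<^sub>M lborel)"
    unfolding split_beta' by measurable
  have m3: "(\<lambda>(x, t). ennreal (\<rho> x ^ n) * (H x * indicator K x) *
       (ennreal (n / t ^ Suc n) * indicator {\<rho> x<..} t)) \<in> borel_measurable (m \<Otimes>\<^sub>M lborel)"
    unfolding split_beta' indicator_def[of "{_<..}"] greaterThan_iff by measurable
  \<comment> \<open>Substitute \<open>u = \<rho> x * t\<close> for fixed \<open>x\<close>, then replace \<open>t * x\<close> by \<open>x\<close> for fixed \<open>t\<close>.\<close>
  have "(\<integral>\<^sup>+u. (\<integral>\<^sup>+x. H (\<lambda>i\<in>I. u * x i / \<rho> x) * indicator K1 x \<partial>m) * c u \<partial>lborel)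
      = (\<integral>\<^sup>+u. (\<integral>\<^sup>+x. H (\<lambda>i\<in>I. u * x i / \<rho> x) * indicator K1 x * c u \<partial>m) \<partial>lborel)"
  proof (rule nn_integral_cong)
    fix u :: real
    have "(\<lambda>x. (\<lambda>i\<in>I. u * x i / \<rho> x)) \<in> measurable m m"
      using measurable_compose[OF measurable_Pair2'[of u lborel m] sc1] by simp
    then have "(\<lambda>x. H (\<lambda>i\<in>I. u * x i / \<rho> x) * indicator K1 x) \<in> borel_measurable m"
      using rHK(2) by measurable
    then show "(\<integral>\<^sup>+x. H (\<lambda>i\<in>I. u * x i / \<rho> x) * indicator K1 x \<partial>m) * c u
      = (\<integral>\<^sup>+x. H (\<lambda>i\<in>I. u * x i / \<rho> x) * indicator K1 x * c u \<partial>m)"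
      by (rule nn_integral_multc[symmetric])
  qed
  also have "\<dots> = (\<integral>\<^sup>+x. (\<integral>\<^sup>+u. H (\<lambda>i\<in>I. u * x i / \<rho> x) * indicator K1 x * c u \<partial>lborel) \<partial>m)"
    using P.Fubini'[OF m1] by simp
  also have "\<dots> = (\<integral>\<^sup>+x. (\<integral>\<^sup>+t. ennreal (\<rho> x ^ n) * indicator K1 x * H (\<lambda>i\<in>I. t * x i) * c t \<partial>lborel) \<partial>m)"
  proof (rule nn_integral_cong)
    fix x assume x: "x \<in> space m"
    show "(\<integral>\<^sup>+u. H (\<lambda>i\<in>I. u * x i / \<rho> x) * indicator K1 x * c u \<partial>lborel)
        = (\<integral>\<^sup>+t. ennreal (\<rho> x ^ n) * indicator K1 x * H (\<lambda>i\<in>I. t * x i) * c t \<partial>lborel)"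
    proof (cases "x \<in> K1")
      case False then show ?thesis by simp
    next
      case True
      then have r: "\<rho> x > 0" using pos by (simp add: K1_def)
      define g where "g u = H (\<lambda>i\<in>I. u * x i / \<rho> x) * indicator K1 x * c u" for u
      have g[measurable]: "g \<in> borel_measurable borel"
        using measurable_compose[OF measurable_Pair1'[OF x, of lborel] m1] by (simp add: g_def[abs_def])
      have "(\<integral>\<^sup>+u. g u \<partial>lborel) = ennreal (\<rho> x) * (\<integral>\<^sup>+t. g (0 + \<rho> x * t) \<partial>lborel)"
        using r by (subst nn_integral_real_affine[OF g, where c="\<rho> x" and t=0]) auto
      also have "\<dots> = (\<integral>\<^sup>+t. ennreal (\<rho> x) * g (0 + \<rho> x * t) \<partial>lborel)"
        by (rule nn_integral_cmult[symmetric]) measurable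
      finally have "(\<integral>\<^sup>+u. H (\<lambda>i\<in>I. u * x i / \<rho> x) * indicator K1 x * c u \<partial>lborel)
          = (\<integral>\<^sup>+t. ennreal (\<rho> x) * (H (\<lambda>i\<in>I. (0 + \<rho> x * t) * x i / \<rho> x) * indicator K1 x * c (0 + \<rho> x * t)) \<partial>lborel)"
        unfolding g_def .
      also have "\<dots> = (\<integral>\<^sup>+t. ennreal (\<rho> x ^ n) * indicator K1 x * H (\<lambda>i\<in>I. t * x i) * c t \<partial>lborel)"
      proof (rule nn_integral_cong)
        fix t :: real
        have "ennreal (\<rho> x) * c (0 + \<rho> x * t) = ennreal (\<rho> x ^ n) * c t"
        proof (cases "t > 0")
          case True
          have "\<rho> x * (n * (\<rho> x * t) ^ (n - 1)) = \<rho> x ^ n * (n * t ^ (n - 1))"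
            using n by (cases n) (auto simp: power_mult_distrib)
          then show ?thesis using True r by (simp add: c_def ennreal_mult[symmetric])
        next
          case False
          then show ?thesis using r by (simp add: c_def zero_less_mult_iff)
        qed
        moreover have "(\<lambda>i\<in>I. (0 + \<rho> x * t) * x i / \<rho> x) = (\<lambda>i\<in>I. t * x i)"
          using r by (auto simp: restrict_def)
        ultimately show "ennreal (\<rho> x) * (H (\<lambda>i\<in>I. (0 + \<rho> x * t) * x i / \<rho> x) * indicator K1 x * c (0 + \<rho> x * t))
          = ennreal (\<rho> x ^ n) * indicator K1 x * H (\<lambda>i\<in>I. t * x i) * c t"
          by (simp only: mult.assoc mult.left_commute[of "ennreal (\<rho> x)"] mult.left_commute[of "ennreal (\<rho> x ^ n)"])
             (simp only: ac_simps)
      qed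
      finally show ?thesis .
    qed
  qed
  also have "\<dots> = (\<integral>\<^sup>+t. (\<integral>\<^sup>+x. ennreal (\<rho> x ^ n) * indicator K1 x * H (\<lambda>i\<in>I. t * x i) * c t \<partial>m) \<partial>lborel)"
    using P.Fubini'[OF m2] by simp
  also have "\<dots> = (\<integral>\<^sup>+t. (\<integral>\<^sup>+x. ennreal (\<rho> x ^ n) * (H x * indicator K x) *
       (ennreal (n / t ^ Suc n) * indicator {\<rho> x<..} t) \<partial>m) \<partial>lborel)"
  proof (rule nn_integral_cong)
    fix t :: real
    show "(\<integral>\<^sup>+x. ennreal (\<rho> x ^ n) * indicator K1 x * H (\<lambda>i\<in>I. t * x i) * c t \<partial>m)
      = (\<integral>\<^sup>+x. ennreal (\<rho> x ^ n) * (H x * indicator K x) * (ennreal (n / t ^ Suc n) * indicator {\<rho> x<..} t) \<partial>m)"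
    proof (cases "t > 0")
      case False
      have "\<not> \<rho> x < t" if "x \<in> K" for x using pos[OF that] False by simp
      then have "(\<lambda>x. ennreal (\<rho> x ^ n) * (H x * indicator K x) * (ennreal (n / t ^ Suc n) * indicator {\<rho> x<..} t)) = (\<lambda>x. 0)"
        by (auto simp: indicator_def fun_eq_iff)
      then show ?thesis using False by (simp add: c_def)
    next
      case t: True
      define L where "L x = ennreal (\<rho> x ^ n) * (H x * indicator K x) * (ennreal (n / t) * indicator {..<t} (\<rho> x))" for x
      have L: "L \<in> borel_measurable m" unfolding L_def by measurable
      have "(\<integral>\<^sup>+x. ennreal (\<rho> x ^ n) * indicator K1 x * H (\<lambda>i\<in>I. t * x i) * c t \<partial>m)
          = (\<integral>\<^sup>+x. L (\<lambda>i\<in>I. t * x i) \<partial>m)"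
      proof (rule nn_integral_cong)
        fix x assume x: "x \<in> space m"
        have k: "(\<lambda>i\<in>I. t * x i) \<in> K \<longleftrightarrow> x \<in> K" using cone[of x t] x t by (simp add: m_def)
        show "ennreal (\<rho> x ^ n) * indicator K1 x * H (\<lambda>i\<in>I. t * x i) * c t = L (\<lambda>i\<in>I. t * x i)"
        proof (cases "x \<in> K \<and> \<rho> x < 1")
          case True
          then have r: "\<rho> x > 0" using pos by auto
          have h: "\<rho> (\<lambda>i\<in>I. t * x i) = t * \<rho> x" using hom True t by auto
          have "ennreal (\<rho> x ^ n) * ennreal (n * t ^ (n - 1)) = ennreal ((t * \<rho> x) ^ n) * ennreal (n / t)"
            using n t r by (cases n) (auto simp: ennreal_mult[symmetric] power_mult_distrib)
          then have "(ennreal (\<rho> x ^ n) * ennreal (n * t ^ (n - 1))) * H (\<lambda>i\<in>I. t * x i)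
             = (ennreal ((t * \<rho> x) ^ n) * ennreal (n / t)) * H (\<lambda>i\<in>I. t * x i)"
            by (rule arg_cong)
          moreover have "ennreal (\<rho> x ^ n) * indicator K1 x * H (\<lambda>i\<in>I. t * x i) * c t
             = (ennreal (\<rho> x ^ n) * ennreal (n * t ^ (n - 1))) * H (\<lambda>i\<in>I. t * x i)"
            using True t by (simp add: K1_def c_def ac_simps)
          moreover have "L (\<lambda>i\<in>I. t * x i) = (ennreal ((t * \<rho> x) ^ n) * ennreal (n / t)) * H (\<lambda>i\<in>I. t * x i)"
            using True k h t r by (simp add: L_def ac_simps)
          ultimately show ?thesis by simp
        next
          case False
          then show ?thesis using k hom[of x t] t by (auto simp: L_def K1_def)
        qed
      qed
      also have "\<dots> = ennreal (1 / t ^ n) * (\<integral>\<^sup>+x. L x \<partial>m)"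
        using nn_integral_PiM_lborel_scale[OF I(1) t, of L] L unfolding m_def \<mu>_def n_def by simp
      also have "\<dots> = (\<integral>\<^sup>+x. ennreal (1 / t ^ n) * L x \<partial>m)" using L by (simp add: nn_integral_cmult)
      also have "\<dots> = (\<integral>\<^sup>+x. ennreal (\<rho> x ^ n) * (H x * indicator K x) * (ennreal (n / t ^ Suc n) * indicator {\<rho> x<..} t) \<partial>m)"
      proof (rule nn_integral_cong)
        fix x
        have "ennreal (1 / t ^ n) * ennreal (n / t) = ennreal (n / t ^ Suc n)"
          using t by (simp add: ennreal_mult[symmetric] mult.commute)
        then show "ennreal (1 / t ^ n) * L x = ennreal (\<rho> x ^ n) * (H x * indicator K x) * (ennreal (n / t ^ Suc n) * indicator {\<rho> x<..} t)"
          by (auto simp: L_def indicator_def ac_simps) 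
      qed
      finally show ?thesis .
    qed
  qed
  also have "\<dots> = (\<integral>\<^sup>+x. (\<integral>\<^sup>+t. ennreal (\<rho> x ^ n) * (H x * indicator K x) *
       (ennreal (n / t ^ Suc n) * indicator {\<rho> x<..} t) \<partial>lborel) \<partial>m)"
    using P.Fubini'[OF m3] by simp
  also have "\<dots> = (\<integral>\<^sup>+x. H x * indicator K x \<partial>m)"
  proof (rule nn_integral_cong)
    fix x
    show "(\<integral>\<^sup>+t. ennreal (\<rho> x ^ n) * (H x * indicator K x) * (ennreal (n / t ^ Suc n) * indicator {\<rho> x<..} t) \<partial>lborel)
       = H x * indicator K x"
    proof (cases "x \<in> K")
      case True
      then have r: "\<rho> x > 0" by (rule pos)
      have "(\<integral>\<^sup>+t. ennreal (n / t ^ Suc n) * indicator {\<rho> x<..} t \<partial>lborel)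
          = (\<integral>\<^sup>+t. ennreal (n / t ^ Suc n) * indicator {\<rho> x..} t \<partial>lborel)"
        by (intro nn_integral_cong_AE eventually_mono[OF AE_lborel_singleton[of "\<rho> x"]])
           (auto simp: indicator_def)
      also have "\<dots> = ennreal (1 / \<rho> x ^ n)" by (rule nn_integral_inverse_power_tail[OF r n])
      finally have tail: "(\<integral>\<^sup>+t. ennreal (n / t ^ Suc n) * indicator {\<rho> x<..} t \<partial>lborel) = ennreal (1 / \<rho> x ^ n)" .
      have "(\<integral>\<^sup>+t. ennreal (\<rho> x ^ n) * (H x * indicator K x) * (ennreal (n / t ^ Suc n) * indicator {\<rho> x<..} t) \<partial>lborel)
        = ennreal (\<rho> x ^ n) * (H x * indicator K x) * ennreal (1 / \<rho> x ^ n)"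
        using tail by (subst nn_integral_cmult) simp_all
      also have "\<dots> = (ennreal (\<rho> x ^ n) * ennreal (1 / \<rho> x ^ n)) * (H x * indicator K x)"
        by (simp only: ac_simps)
      also have "ennreal (\<rho> x ^ n) * ennreal (1 / \<rho> x ^ n) = 1"
        using r by (simp add: ennreal_mult[symmetric])
      finally show ?thesis by simp
    qed simp
  qed
  finally show ?thesis by (simp add: m_def K1_def c_def n_def)
qed

section \<open>Order statistics and spacings\<close>

lemma sort_nth_le_iff:
  fixes xs :: "real list"
  assumes k: "k < length xs"
  shows "sort xs ! k \<le> c \<longleftrightarrow> k < length (filter (\<lambda>v. v \<le> c) xs)"
proof -
  define ys where "ys = sort xs"
  have ys: "sorted ys" "length ys = length xs" by (simp_all add: ys_def)
  have len: "length (filter (\<lambda>v. v \<le> c) xs) = length (filter (\<lambda>v. v \<le> c) ys)"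
    unfolding ys_def by (metis mset_filter mset_sort size_mset)
  have split: "filter (\<lambda>v. v \<le> c) ys = filter (\<lambda>v. v \<le> c) (take j ys) @ filter (\<lambda>v. v \<le> c) (drop j ys)" for j
    by (metis append_take_drop_id filter_append)
  have le: "ys ! i \<le> ys ! j" if "i \<le> j" "j < length ys" for i j
    using sorted_nth_mono[OF ys(1) that] .
  show ?thesis
  proof (cases "ys ! k \<le> c")
    case True
    have "v \<le> c" if "v \<in> set (take (Suc k) ys)" for v
      using that le k ys(2) True by (fastforce simp: in_set_conv_nth less_Suc_eq_le)
    then have "filter (\<lambda>v. v \<le> c) (take (Suc k) ys) = take (Suc k) ys" by (simp add: filter_id_conv)
    then have "length (filter (\<lambda>v. v \<le> c) ys) \<ge> Suc k"
      using split[of "Suc k"] k ys(2) by simp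
    then show ?thesis using True len by (simp add: ys_def)
  next
    case False
    have "\<not> v \<le> c" if v: "v \<in> set (drop k ys)" for v
    proof -
      obtain i where "i < length (drop k ys)" "drop k ys ! i = v" using v unfolding in_set_conv_nth by blast
      then have "i < length ys - k" "v = ys ! (k + i)" using k ys(2) by auto
      then have "ys ! k \<le> v" using le[of k "k + i"] k ys(2) by auto
      then show ?thesis using False by simp
    qed
    then have "filter (\<lambda>v. v \<le> c) (drop k ys) = []" by (simp add: filter_empty_conv)
    then have "length (filter (\<lambda>v. v \<le> c) ys) \<le> k"
      using split[of k] length_filter_le[of "\<lambda>v. v \<le> c" "take k ys"] k ys(2) by simp
    then show ?thesis using False len by (simp add: ys_def)
  qed
qed

lemma sort_map_mono:
  fixes f :: "real \<Rightarrow> real"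
  assumes "mono f"
  shows "sort (map f xs) = map f (sort xs)"
  by (rule properties_for_sort)
     (use assms in \<open>auto intro!: sorted_map_mono simp: mono_on_def mono_def\<close>)

text \<open>The sample space is taken to be the space of vectors and the observations its coordinates.\<close>

abbreviation ostat :: "nat \<Rightarrow> nat \<Rightarrow> (nat \<Rightarrow> real) \<Rightarrow> real" where
  "ostat n k x \<equiv> order_statistic n (\<lambda>i x. x i) k x"

lemma order_statistic_eq_ostat:
  "order_statistic n X k \<omega> = ostat n k (\<lambda>i\<in>{1..n}. X i \<omega>)"
  unfolding order_statistic_def
  by (rule arg_cong[where f="\<lambda>xs. sort xs ! (k - 1)"]) auto

lemma ostat_scale:
  assumes k: "k \<in> {1..n}" and "c > 0"
  shows "ostat n k (\<lambda>i\<in>{1..n}. c * x i) = c * ostat n k x"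
proof -
  have "map (\<lambda>i. (\<lambda>i\<in>{1..n}. c * x i) i) [1..<Suc n] = map ((*) c) (map x [1..<Suc n])" by auto
  moreover have "mono ((*) c)" using \<open>c > 0\<close> by (simp add: mono_def)
  ultimately have "sort (map (\<lambda>i. (\<lambda>i\<in>{1..n}. c * x i) i) [1..<Suc n]) = map ((*) c) (sort (map x [1..<Suc n]))"
    using sort_map_mono by metis
  moreover have "k - 1 < length (sort (map x [1..<Suc n]))" using k by auto
  ultimately show ?thesis unfolding order_statistic_def by (metis nth_map)
qed

text \<open>The \<open>k\<close>-th smallest value is at most \<open>c\<close> iff at least \<open>k\<close> values are; the count is visibly measurable.\<close>

lemma ostat_le_iff:
  assumes "k \<in> {1..n}"
  shows "ostat n k x \<le> c \<longleftrightarrow> real k \<le> (\<Sum>i\<in>{1..n}. indicator {..c} (x i))"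
proof -
  have "length (filter (\<lambda>v. v \<le> c) (map x [1..<Suc n])) = card {i\<in>{1..n}. x i \<le> c}"
    by (subst filter_map, subst length_map, subst distinct_card[symmetric])
       (auto intro!: arg_cong[where f=card])
  moreover have "real (card {i\<in>{1..n}. x i \<le> c}) = (\<Sum>i\<in>{1..n}. indicator {..c} (x i))"
    by (simp add: indicator_def sum.If_cases Int_def conj_commute)
  ultimately show ?thesis
    using assms sort_nth_le_iff[of "k - 1" "map x [1..<Suc n]" c] unfolding order_statistic_def
    by (simp del: upt_Suc) linarith
qed

lemma measurable_ostat:
  assumes "k \<in> {1..n}"
  shows "ostat n k \<in> borel_measurable (PiM {1..n} (\<lambda>_. lborel))"
proof (rule borel_measurable_iff_le[THEN iffD2, rule_format])
  fix c :: real
  have [measurable]: "(\<lambda>x. \<Sum>i\<in>{1..n}. indicator {..c} (x i) :: real) \<in> borel_measurable (PiM {1..n} (\<lambda>_. lborel))"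
    by (intro borel_measurable_sum measurable_compose[OF measurable_component_PiM_lborel]) auto
  show "{x \<in> space (PiM {1..n} (\<lambda>_. lborel)). ostat n k x \<le> c} \<in> sets (PiM {1..n} (\<lambda>_. lborel))"
    unfolding ostat_le_iff[OF assms] by measurable
qed

lemma ostat_in_range:
  assumes "k \<in> {1..n}"
  shows "\<exists>i\<in>{1..n}. ostat n k x = x i"
proof -
  have "sort (map x [1..<Suc n]) ! (k - 1) \<in> set (sort (map x [1..<Suc n]))"
    using assms by (intro nth_mem) auto
  then show ?thesis by (auto simp: order_statistic_def)
qed

lemma ostat_range_bound:
  assumes "i \<in> {1..n}"
  shows "ostat n 1 x \<le> x i" "x i \<le> ostat n n x"
proof -
  define ys where "ys = sort (map x [1..<Suc n])"
  have "set ys = x ` {1..n}" unfolding ys_def set_sort set_map by (rule arg_cong[where f="image x"]) auto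
  then have "x i \<in> set ys" using assms by simp
  then obtain j where j: "j < length ys" "x i = ys ! j" by (auto simp: in_set_conv_nth)
  have len: "length ys = n" "sorted ys" by (auto simp: ys_def)
  show "ostat n 1 x \<le> x i" "x i \<le> ostat n n x"
    using sorted_nth_mono[OF len(2), of 0 j] sorted_nth_mono[OF len(2), of j "n - 1"] j len(1)
    unfolding order_statistic_def ys_def by auto
qed

definition spacing_root :: "nat \<Rightarrow> (nat \<Rightarrow> nat \<Rightarrow> real) \<Rightarrow> real \<Rightarrow> (nat \<Rightarrow> real) \<Rightarrow> real" where
  "spacing_root n a p x = spacing_statistic n a p (\<lambda>i x. x i) x powr (1 / p)"

lemma spacing_statistic_eq:
  "spacing_statistic n a p X \<omega> powr (1 / p) = spacing_root n a p (\<lambda>i\<in>{1..n}. X i \<omega>)"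
  unfolding spacing_root_def spacing_statistic_def order_statistic_eq_ostat[of n X] by simp

lemma spacing_root_scale:
  assumes "c > 0" "p > 0" and nn: "\<And>i j. i \<in> {1..n} \<Longrightarrow> j \<in> {1..n} \<Longrightarrow> a i j \<ge> 0"
  shows "spacing_root n a p (\<lambda>i\<in>{1..n}. c * x i) = c * spacing_root n a p x"
proof -
  have "spacing_statistic n a p (\<lambda>i x. x i) (\<lambda>i\<in>{1..n}. c * x i)
     = c powr p * spacing_statistic n a p (\<lambda>i x. x i) x"
    unfolding spacing_statistic_def sum_distrib_left
  proof (intro sum.cong refl)
    fix i j assume ij: "i \<in> {1..n}" "j \<in> {1..n}"
    have "\<bar>c * ostat n i x - c * ostat n j x\<bar> = c * \<bar>ostat n i x - ostat n j x\<bar>"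
      using \<open>c > 0\<close> by (metis abs_mult abs_of_pos right_diff_distrib)
    then show "a i j * \<bar>ostat n i (\<lambda>i\<in>{1..n}. c * x i) - ostat n j (\<lambda>i\<in>{1..n}. c * x i)\<bar> powr p
      = c powr p * (a i j * \<bar>ostat n i x - ostat n j x\<bar> powr p)"
      using \<open>c > 0\<close> by (simp only: ostat_scale[OF ij(1) \<open>c > 0\<close>] ostat_scale[OF ij(2) \<open>c > 0\<close>]) (simp add: powr_mult)
  qed
  moreover have "spacing_statistic n a p (\<lambda>i x. x i) x \<ge> 0"
    unfolding spacing_statistic_def by (intro sum_nonneg mult_nonneg_nonneg nn) auto
  ultimately show ?thesis
    using assms by (simp add: spacing_root_def powr_mult powr_powr)
qed

lemma measurable_spacing_root:
  "spacing_root n a p \<in> borel_measurable (PiM {1..n} (\<lambda>_. lborel))"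
  unfolding spacing_root_def[abs_def] spacing_statistic_def
  by (intro powr_real_measurable borel_measurable_sum borel_measurable_times borel_measurable_const
      borel_measurable_abs borel_measurable_diff measurable_ostat) auto

text \<open>The two terms that compare the extreme order statistics already control all differences.\<close>

lemma spacing_root_ge:
  assumes n: "n \<ge> 2" and p: "p > 0"
    and nn: "\<And>i j. i \<in> {1..n} \<Longrightarrow> j \<in> {1..n} \<Longrightarrow> a i j \<ge> 0"
    and ij: "i \<in> {1..n}" "j \<in> {1..n}"
  shows "(a 1 n + a n 1) powr (1 / p) * \<bar>x i - x j\<bar> \<le> spacing_root n a p x"
proof -
  define D where "D = \<bar>ostat n 1 x - ostat n n x\<bar>"
  have range: "\<bar>x i - x j\<bar> \<le> D"
    using ostat_range_bound[OF ij(1), of x] ostat_range_bound[OF ij(2), of x] by (simp add: D_def)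
  define T where "T i j = a i j * \<bar>ostat n i x - ostat n j x\<bar> powr p" for i j
  have T: "T i j \<ge> 0" if "i \<in> {1..n}" "j \<in> {1..n}" for i j
    unfolding T_def using nn[OF that] by simp
  have 1: "1 \<in> {1..n}" "n \<in> {1..n}" using n by auto
  have "(a 1 n + a n 1) * D powr p = T 1 n + T n 1"
    by (simp add: T_def D_def abs_minus_commute algebra_simps)
  also have "\<dots> \<le> (\<Sum>j\<in>{1..n}. T 1 j) + (\<Sum>j\<in>{1..n}. T n j)"
    by (intro add_mono member_le_sum T 1) auto
  also have "\<dots> = (\<Sum>i\<in>{1, n}. \<Sum>j\<in>{1..n}. T i j)" using n by simp
  also have "\<dots> \<le> (\<Sum>i\<in>{1..n}. \<Sum>j\<in>{1..n}. T i j)"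
    by (intro sum_mono2 sum_nonneg T) (use 1 in auto)
  also have "\<dots> = spacing_statistic n a p (\<lambda>i x. x i) x" by (simp add: spacing_statistic_def T_def)
  finally have le: "(a 1 n + a n 1) * D powr p \<le> spacing_statistic n a p (\<lambda>i x. x i) x" .
  have A: "a 1 n + a n 1 \<ge> 0" using nn[OF 1] nn[OF 1(2,1)] by simp
  have "(a 1 n + a n 1) powr (1 / p) * \<bar>x i - x j\<bar> \<le> (a 1 n + a n 1) powr (1 / p) * D"
    using range by (intro mult_left_mono) auto
  also have "\<dots> = ((a 1 n + a n 1) * D powr p) powr (1 / p)"
    using A p by (simp add: powr_mult powr_powr D_def)
  also have "\<dots> \<le> spacing_root n a p x"
    unfolding spacing_root_def using le A p by (intro powr_mono2) auto
  finally show ?thesis .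
qed

lemma spacing_root_le:
  assumes p: "p > 0" and nn: "\<And>i j. i \<in> {1..n} \<Longrightarrow> j \<in> {1..n} \<Longrightarrow> a i j \<ge> 0"
    and uv: "u \<le> v" "\<And>i. i \<in> {1..n} \<Longrightarrow> u \<le> x i \<and> x i \<le> v"
  shows "spacing_root n a p x \<le> (\<Sum>i=1..n. \<Sum>j=1..n. a i j) powr (1 / p) * (v - u)"
proof -
  have d: "\<bar>ostat n i x - ostat n j x\<bar> \<le> v - u" if ij: "i \<in> {1..n}" "j \<in> {1..n}" for i j
  proof -
    obtain i' j' where "i' \<in> {1..n}" "ostat n i x = x i'" "j' \<in> {1..n}" "ostat n j x = x j'"
      using ostat_in_range[OF ij(1), of x] ostat_in_range[OF ij(2), of x] by blast
    with uv(2)[of i'] uv(2)[of j'] show ?thesis by linarith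
  qed
  have "spacing_statistic n a p (\<lambda>i x. x i) x \<le> (\<Sum>i=1..n. \<Sum>j=1..n. a i j * (v - u) powr p)"
    unfolding spacing_statistic_def using p
    by (intro sum_mono mult_left_mono powr_mono2 d nn) auto
  also have "\<dots> = (\<Sum>i=1..n. \<Sum>j=1..n. a i j) * (v - u) powr p" by (simp add: sum_distrib_right)
  finally have le: "spacing_statistic n a p (\<lambda>i x. x i) x \<le> (\<Sum>i=1..n. \<Sum>j=1..n. a i j) * (v - u) powr p" .
  have "spacing_statistic n a p (\<lambda>i x. x i) x \<ge> 0"
    unfolding spacing_statistic_def by (intro sum_nonneg mult_nonneg_nonneg nn) auto
  then have "spacing_root n a p x \<le> ((\<Sum>i=1..n. \<Sum>j=1..n. a i j) * (v - u) powr p) powr (1 / p)"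
    unfolding spacing_root_def using le p by (intro powr_mono2) auto
  also have "\<dots> = (\<Sum>i=1..n. \<Sum>j=1..n. a i j) powr (1 / p) * (v - u)"
    using p uv(1) nn by (subst powr_mult) (auto intro!: sum_nonneg simp: powr_powr)
  finally show ?thesis .
qed

section \<open>Densities of gamma type\<close>

lemma nn_integral_ge_log:
  fixes f :: "real \<Rightarrow> real"
  assumes f: "f \<in> borel_measurable borel" and "c > 0" "0 < a" "a \<le> b"
    and ge: "\<And>x. x \<in> {a..b} \<Longrightarrow> c / x \<le> f x"
  shows "ennreal (c * (ln b - ln a)) \<le> (\<integral>\<^sup>+x. ennreal (f x) \<partial>lborel)"
proof -
  have "(\<integral>\<^sup>+x. ennreal (c / x) * indicator {a..b} x \<partial>lborel) = ennreal (c * ln b - c * ln a)"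
  proof (rule nn_integral_FTC_Icc)
    show "((\<lambda>x. c * ln x) has_real_derivative c / x) (at x)" if "x \<in> {a..b}" for x
      using that assms by (auto intro!: derivative_eq_intros)
  qed (use assms in auto)
  moreover have "(\<integral>\<^sup>+x. ennreal (c / x) * indicator {a..b} x \<partial>lborel) \<le> (\<integral>\<^sup>+x. ennreal (f x) \<partial>lborel)"
    by (intro nn_integral_mono) (auto simp: indicator_def intro!: ennreal_leI ge)
  ultimately show ?thesis by (simp add: right_diff_distrib)
qed

text \<open>For any other exponents \<open>f\<close> dominates a multiple of \<open>1 / x\<close> near zero or near infinity, with divergent integral.\<close>

lemma powr_exp_integrable_exponents:
  assumes C: "C > 0" and f: "\<And>x. x > 0 \<Longrightarrow> f x = C * x powr k * exp (\<beta> * x)"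
    and [measurable]: "f \<in> borel_measurable borel"
    and le1: "(\<integral>\<^sup>+x. ennreal (f x) \<partial>lborel) \<le> 1"
  shows "k > -1" "\<beta> < 0"
proof -
  \<comment> \<open>On an interval of logarithmic length \<open>2 / c\<close> a density above \<open>c / x\<close> has mass two.\<close>
  have no: False if "c > 0" "0 < a" "a \<le> b" "c * (ln b - ln a) = 2" "\<And>x. x \<in> {a..b} \<Longrightarrow> c / x \<le> f x" for a b c
    using order_trans[OF nn_integral_ge_log[OF _ that(1-3,5)] le1] that(4) by simp
  show k: "k > -1"
  proof (rule ccontr)
    assume k: "\<not> k > -1"
    define c where "c = C * exp (- \<bar>\<beta>\<bar>)"
    have c: "c > 0" using C by (simp add: c_def)
    show False
    proof (rule no[of c "exp (- (2 / c))" 1])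
      fix x assume "x \<in> {exp (- (2 / c))..1}"
      then have x: "0 < x" "x \<le> 1" by (auto intro: less_le_trans[OF exp_gt_zero])
      have "x powr -1 \<le> x powr k" using x k by (intro powr_mono') auto
      moreover have "exp (- \<bar>\<beta>\<bar>) \<le> exp (\<beta> * x)"
      proof -
        have "\<bar>\<beta> * x\<bar> \<le> \<bar>\<beta>\<bar>" using x by (simp add: abs_mult mult_left_le)
        then show ?thesis by simp
      qed
      ultimately have "x powr -1 * exp (- \<bar>\<beta>\<bar>) \<le> x powr k * exp (\<beta> * x)" by (intro mult_mono) auto
      then have "C * (x powr -1 * exp (- \<bar>\<beta>\<bar>)) \<le> C * (x powr k * exp (\<beta> * x))"
        using C by (intro mult_left_mono) auto
      moreover have "C * (x powr -1 * exp (- \<bar>\<beta>\<bar>)) = c / x" using x by (simp add: c_def powr_minus_divide)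
      moreover have "C * (x powr k * exp (\<beta> * x)) = f x" using x by (simp add: f)
      ultimately show "c / x \<le> f x" by (simp only:)
    qed (use c in auto)
  qed
  show "\<beta> < 0"
  proof (rule ccontr)
    assume \<beta>: "\<not> \<beta> < 0"
    show False
    proof (rule no[of C 1 "exp (2 / C)"])
      fix x assume "x \<in> {1..exp (2 / C)}"
      then have x: "1 \<le> x" by simp
      have "x powr -1 \<le> x powr k" using x k by (intro powr_mono) auto
      moreover have "1 \<le> exp (\<beta> * x)" using x \<beta> by simp
      ultimately have "x powr -1 * 1 \<le> x powr k * exp (\<beta> * x)" by (intro mult_mono) auto
      then have "C * x powr -1 \<le> C * (x powr k * exp (\<beta> * x))"
        using C by (intro mult_left_mono) auto
      moreover have "C * x powr -1 = C / x" using x by (simp add: powr_minus_divide)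
      moreover have "C * (x powr k * exp (\<beta> * x)) = f x" using x by (simp add: f)
      ultimately show "C / x \<le> f x" by (simp only:)
    qed (use C in auto)
  qed
qed

lemma nn_integral_gamma_density:
  assumes a: "a > 0" and b: "b > 0"
  shows "(\<integral>\<^sup>+x. ennreal (gamma_density a b x) \<partial>lborel) = 1"
proof -
  define g where "g t = ennreal (indicator {0..} t * t powr (a - 1) / exp t)" for t :: real
  have g: "g \<in> borel_measurable borel" unfolding g_def by measurable
  have Ga: "Gamma a > 0" using a by (rule Gamma_real_pos)
  have dens: "ennreal (gamma_density a b x) = ennreal (1 / Gamma a) * (ennreal (1 / b) * g (0 + 1 / b * x))" for x
  proof (cases "x > 0")
    case True
    have "b powr a = b * b powr (a - 1)" using b by (simp add: powr_diff)
    then have "gamma_density a b x = 1 / Gamma a * (1 / b * ((x / b) powr (a - 1) / exp (x / b)))"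
      using True b Ga powr_divide[of x b "a - 1"] exp_minus[of "x / b"]
      by (simp add: gamma_density_def field_simps)
    then show ?thesis using True a b Ga by (simp add: g_def ennreal_mult[symmetric])
  next
    case False
    then show ?thesis using b by (cases "x = 0") (auto simp: gamma_density_def g_def divide_less_0_iff indicator_def zero_le_divide_iff)
  qed
  have "(\<integral>\<^sup>+x. ennreal (gamma_density a b x) \<partial>lborel)
      = ennreal (1 / Gamma a) * (ennreal (1 / b) * (\<integral>\<^sup>+x. g (0 + 1 / b * x) \<partial>lborel))"
    unfolding dens using g by (simp add: nn_integral_cmult)
  also have "ennreal (1 / b) * (\<integral>\<^sup>+x. g (0 + 1 / b * x) \<partial>lborel) = (\<integral>\<^sup>+x. g x \<partial>lborel)"
    using nn_integral_real_affine[OF g, of "1 / b" 0] b by simp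
  also have "\<dots> = ennreal (Gamma a)" unfolding g_def by (rule Gamma_conv_nn_integral_real[OF a, symmetric])
  also have "ennreal (1 / Gamma a) * ennreal (Gamma a) = 1"
    using Ga by (simp add: ennreal_mult[symmetric])
  finally show ?thesis .
qed

text \<open>The constant \<open>C\<close> is the right one because both densities have total mass one.\<close>

lemma gamma_distribution_if_powr_exp:
  fixes f :: "real \<Rightarrow> real"
  assumes F: "F = density lborel (\<lambda>x. ennreal (f x))" and prob: "prob_space F"
    and f[measurable]: "f \<in> borel_measurable borel" and nn: "\<And>x. f x \<ge> 0"
    and pos: "AE x in F. x > 0"
    and C: "C > 0" and form: "\<And>x. x > 0 \<Longrightarrow> f x = C * x powr k * exp (\<beta> * x)"
  shows "gamma_distribution F"
proof -
  interpret F: prob_space F by fact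
  have int: "(\<integral>\<^sup>+x. ennreal (f x) \<partial>lborel) = 1"
    using F.emeasure_space_1 by (simp add: F emeasure_density)
  have k: "k > -1" and \<beta>: "\<beta> < 0" using powr_exp_integrable_exponents[OF C form f] int by simp_all
  define a b where "a = k + 1" and "b = - 1 / \<beta>"
  have ab: "a > 0" "b > 0" using k \<beta> by (simp_all add: a_def b_def)
  define D where "D = 1 / (Gamma a * b powr a)"
  have D: "D > 0" using ab by (simp add: D_def Gamma_real_pos)
  have zero: "AE x in lborel. \<not> x > 0 \<longrightarrow> f x = 0"
  proof -
    have "AE x in lborel. 0 < ennreal (f x) \<longrightarrow> x > 0" using pos unfolding F by (subst (asm) AE_density) auto
    then show ?thesis by eventually_elim (use nn in \<open>auto simp: not_less antisym\<close>)
  qed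
  have eq: "AE x in lborel. ennreal (f x) = ennreal (C / D) * ennreal (gamma_density a b x)"
    using zero
  proof eventually_elim
    case (elim x)
    show ?case
    proof (cases "x > 0")
      case True
      have "gamma_density a b x = D * x powr k * exp (\<beta> * x)"
        using True \<beta> by (simp add: gamma_density_def D_def a_def b_def)
      then have "f x = C / D * gamma_density a b x" using True D by (simp add: form)
      moreover have "ennreal (C / D * gamma_density a b x) = ennreal (C / D) * ennreal (gamma_density a b x)"
        using C D by (intro ennreal_mult') simp
      ultimately show ?thesis by simp
    qed (use elim in \<open>simp add: gamma_density_def\<close>)
  qed
  have gd[measurable]: "gamma_density a b \<in> borel_measurable borel" unfolding gamma_density_def by measurable
  have "1 = (\<integral>\<^sup>+x. ennreal (C / D) * ennreal (gamma_density a b x) \<partial>lborel)"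
    using nn_integral_cong_AE[OF eq] int by simp
  also have "\<dots> = ennreal (C / D)" using nn_integral_gamma_density[OF ab] by (simp add: nn_integral_cmult)
  finally have "ennreal (C / D) = 1" by simp
  then have "F = density lborel (\<lambda>x. ennreal (gamma_density a b x))"
    unfolding F using eq by (intro density_cong) auto
  then show ?thesis unfolding gamma_distribution_def using ab by blast
qed

section \<open>Mean and relative spread of a sample\<close>

text \<open>Two continuous functions that differ at a point differ on a ball, which has positive measure.\<close>

lemma eq_if_AE_eq_continuous:
  fixes g h :: "real \<Rightarrow> real"
  assumes c: "continuous_on {0<..} g" "continuous_on {0<..} h"
    and ae: "AE u in lborel. u > 0 \<longrightarrow> g u = h u" and s: "s > 0"
  shows "g s = h s"
proof (rule ccontr)
  assume ne: "g s \<noteq> h s"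
  have "continuous_on {0<..} (\<lambda>u. g u - h u)" by (intro continuous_intros c)
  then have "open ({0<..} \<inter> (\<lambda>u. g u - h u) -` (- {0}))"
    by (intro continuous_open_preimage) auto
  moreover have "s \<in> {0<..} \<inter> (\<lambda>u. g u - h u) -` (- {0})" using s ne by simp
  ultimately obtain e where e: "e > 0" "ball s e \<subseteq> {0<..} \<inter> (\<lambda>u. g u - h u) -` (- {0})"
    using open_contains_ball by blast
  have "AE u in lborel. u \<notin> ball s e" using ae by eventually_elim (use e(2) in auto)
  then have "emeasure lborel (ball s e) = 0" using AE_iff_null_sets[of "ball s e" lborel] by auto
  then show False using e(1) by (simp add: ball_eq_greaterThanLessThan)
qed

text \<open>The functions \<open>p\<close> and \<open>q\<close> are the two laws up to mutually inverse constants.\<close>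

lemma (in prob_space) indep_var_if_emeasure_product:
  fixes S W :: "'a \<Rightarrow> real"
  assumes [measurable]: "S \<in> borel_measurable M" "W \<in> borel_measurable M"
    and prod: "\<And>A B. A \<in> sets borel \<Longrightarrow> B \<in> sets borel \<Longrightarrow>
      emeasure M {\<omega>\<in>space M. S \<omega> \<in> B \<and> W \<omega> \<in> A} = p B * q A"
  shows "indep_var borel S borel W"
  unfolding indep_var_distribution_eq
proof (intro conjI pair_measure_eqI)
  interpret S: prob_space "distr M borel S" by (rule prob_space_distr) simp
  interpret W: prob_space "distr M borel W" by (rule prob_space_distr) simp
  show "sigma_finite_measure (distr M borel S)" "sigma_finite_measure (distr M borel W)" ..
  fix B A assume "B \<in> sets (distr M borel S)" "A \<in> sets (distr M borel W)"
  then have [measurable]: "B \<in> sets borel" "A \<in> sets borel" by simp_all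
  have S: "emeasure (distr M borel S) B = p B * q UNIV"
    using prod[of UNIV B] by (simp add: emeasure_distr vimage_def Int_def conj_commute)
  have W: "emeasure (distr M borel W) A = p UNIV * q A"
    using prod[of A UNIV] by (simp add: emeasure_distr vimage_def Int_def conj_commute)
  have one: "p UNIV * q UNIV = 1"
    using prod[of UNIV UNIV] by (simp add: emeasure_space_1)
  have "emeasure (distr M (borel \<Otimes>\<^sub>M borel) (\<lambda>x. (S x, W x))) (B \<times> A) = p B * q A"
    using prod[of A B] by (simp add: emeasure_distr vimage_def Int_def conj_commute)
  also have "\<dots> = (p B * q A) * (p UNIV * q UNIV)" by (simp add: one)
  also have "\<dots> = emeasure (distr M borel S) B * emeasure (distr M borel W) A"
    unfolding S W by (simp only: ac_simps)
  finally show "emeasure (distr M borel S) B * emeasure (distr M borel W) A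
    = emeasure (distr M (borel \<Otimes>\<^sub>M borel) (\<lambda>x. (S x, W x))) (B \<times> A)" by simp
qed simp_all

text \<open>Otherwise simplification turns the index set \<open>{1..n}\<close> into \<open>{Suc 0..n}\<close>.\<close>

declare One_nat_def [simp del]

text \<open>All that is used of the root of the spacing statistic: it is homogeneous of degree one and comparable to
  the range of the vector, both from below and from above.\<close>

locale scale_statistic =
  fixes n :: nat and \<tau> :: "(nat \<Rightarrow> real) \<Rightarrow> real" and \<kappa> \<Lambda> :: real
  assumes n: "2 \<le> n"
    and measurable_tau: "\<tau> \<in> borel_measurable (PiM {1..n} (\<lambda>_. lborel))"
    and scale_tau: "c > 0 \<Longrightarrow> \<tau> (\<lambda>i\<in>{1..n}. c * x i) = c * \<tau> x"
    and kappa: "\<kappa> > 0"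
    and tau_ge: "i \<in> {1..n} \<Longrightarrow> j \<in> {1..n} \<Longrightarrow> \<kappa> * \<bar>x i - x j\<bar> \<le> \<tau> x"
    and Lambda: "\<Lambda> \<ge> 0"
    and tau_le: "u \<le> v \<Longrightarrow> (\<And>i. i \<in> {1..n} \<Longrightarrow> u \<le> x i \<and> x i \<le> v) \<Longrightarrow> \<tau> x \<le> \<Lambda> * (v - u)"
begin

abbreviation \<mu> :: "(nat \<Rightarrow> real) measure" where
  "\<mu> \<equiv> PiM {1..n} (\<lambda>_. lborel)"

definition avg :: "(nat \<Rightarrow> real) \<Rightarrow> real" where
  "avg x = (\<Sum>i=1..n. x i) / real n"

definition ratio :: "(nat \<Rightarrow> real) \<Rightarrow> real" where
  "ratio x = \<tau> x / avg x"

definition dir :: "nat \<Rightarrow> (nat \<Rightarrow> real) \<Rightarrow> real" where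
  "dir i x = x i / avg x"

definition orthant :: "(nat \<Rightarrow> real) set" where
  "orthant = Pi\<^sub>E {1..n} (\<lambda>_. {0<..})"

text \<open>A set of finite measure that meets every ray of the orthant in a segment starting at the origin.\<close>

definition base :: "(nat \<Rightarrow> real) set" where
  "base = {x \<in> orthant. avg x < 1}"

text \<open>Up to the factor \<open>radial_weight u\<close>, the density at \<open>u\<close> of the mean of a sample with density \<open>f\<close>,
  restricted to the event that the ratio lies in \<open>A\<close>. The ratio depends on the ray only.\<close>

definition slice :: "(real \<Rightarrow> real) \<Rightarrow> real set \<Rightarrow> real \<Rightarrow> ennreal" where
  "slice f A u = (\<integral>\<^sup>+x. (\<Prod>i\<in>{1..n}. ennreal (f (u * dir i x))) * indicator {x\<in>base. ratio x \<in> A} x \<partial>\<mu>)"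

definition radial_weight :: "real \<Rightarrow> ennreal" where
  "radial_weight u = ennreal (real n * u ^ (n - 1)) * indicator {0<..} u"

lemma measurable_coord: "i \<in> {1..n} \<Longrightarrow> (\<lambda>x. x i) \<in> borel_measurable \<mu>"
  by (rule measurable_component_PiM_lborel)

lemma measurable_avg [measurable]: "avg \<in> borel_measurable \<mu>"
  unfolding avg_def[abs_def]
  by (intro borel_measurable_divide borel_measurable_sum borel_measurable_const measurable_coord)

lemma measurable_ratio [measurable]: "ratio \<in> borel_measurable \<mu>"
  unfolding ratio_def[abs_def] by (intro borel_measurable_divide measurable_tau measurable_avg)

lemma measurable_dir: "i \<in> {1..n} \<Longrightarrow> dir i \<in> borel_measurable \<mu>"
  unfolding dir_def[abs_def] by (intro borel_measurable_divide measurable_coord measurable_avg)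

lemma space_mu: "space \<mu> = extensional {1..n}"
  by (auto simp: space_PiM PiE_def)

lemma orthant_sets [measurable]: "orthant \<in> sets \<mu>"
  unfolding orthant_def by (intro sets_PiM_I_finite) auto

lemma orthant_space: "x \<in> orthant \<Longrightarrow> x \<in> space \<mu>"
  by (auto simp: orthant_def space_mu PiE_def)

lemma base_sets [measurable]: "base \<in> sets \<mu>"
proof -
  have "base = orthant \<inter> {x\<in>space \<mu>. avg x < 1}" using orthant_space by (auto simp: base_def)
  then show ?thesis by simp
qed

lemma base_ratio_sets:
  assumes [measurable]: "A \<in> sets borel"
  shows "{x\<in>base. ratio x \<in> A} \<in> sets \<mu>"
proof -
  have "{x\<in>base. ratio x \<in> A} = base \<inter> (ratio -` A \<inter> space \<mu>)"
    using orthant_space by (auto simp: base_def)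
  then show ?thesis using measurable_sets[OF measurable_ratio assms] by simp
qed

lemma avg_pos: "x \<in> orthant \<Longrightarrow> avg x > 0"
  unfolding avg_def using n by (intro divide_pos_pos sum_pos) (auto simp: orthant_def PiE_def Pi_def)

lemma avg_scale: "avg (\<lambda>i\<in>{1..n}. c * x i) = c * avg x"
  by (simp add: avg_def sum_distrib_left)

lemma ratio_scale: "c > 0 \<Longrightarrow> ratio (\<lambda>i\<in>{1..n}. c * x i) = ratio x"
  by (simp add: ratio_def avg_scale scale_tau)

lemma dir_pos: "x \<in> orthant \<Longrightarrow> i \<in> {1..n} \<Longrightarrow> dir i x > 0"
  unfolding dir_def using avg_pos by (intro divide_pos_pos) (auto simp: orthant_def PiE_def Pi_def)

lemma dir_sum: "x \<in> orthant \<Longrightarrow> (\<Sum>i=1..n. dir i x) = n"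
  using avg_pos[of x] n by (simp add: dir_def sum_divide_distrib[symmetric]) (simp add: avg_def field_simps)

lemma measurable_slice:
  assumes [measurable]: "f \<in> borel_measurable borel" and A: "A \<in> sets borel"
  shows "slice f A \<in> borel_measurable borel"
proof -
  interpret product_sigma_finite "\<lambda>_. lborel :: real measure" by standard
  interpret M: sigma_finite_measure \<mu> by (rule sigma_finite) simp
  have d: "(\<lambda>p. dir i (snd p)) \<in> borel_measurable (borel \<Otimes>\<^sub>M \<mu>)" if "i \<in> {1..n}" for i
    by (rule measurable_compose[OF measurable_snd measurable_dir[OF that]])
  have "(\<lambda>p. \<Prod>i\<in>{1..n}. ennreal (f (fst p * dir i (snd p)))) \<in> borel_measurable (borel \<Otimes>\<^sub>M \<mu>)"
    by (intro borel_measurable_prod_ennreal measurable_compose[OF _ measurable_ennreal]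
          measurable_compose[OF _ assms(1)] borel_measurable_times measurable_fst d)
  moreover note [measurable] = base_ratio_sets[OF A]
  ultimately have "(\<lambda>p. (\<Prod>i\<in>{1..n}. ennreal (f (fst p * dir i (snd p)))) * indicator {x\<in>base. ratio x \<in> A} (snd p))
      \<in> borel_measurable (borel \<Otimes>\<^sub>M \<mu>)"
    by measurable
  then show ?thesis unfolding slice_def[abs_def]
    by (intro M.borel_measurable_nn_integral) (simp add: split_beta')
qed

lemma measurable_radial_weight [measurable]: "radial_weight \<in> borel_measurable borel"
  unfolding radial_weight_def by measurable

lemma polar_slices:
  assumes f[measurable]: "f \<in> borel_measurable borel"
    and A[measurable]: "A \<in> sets borel" and B[measurable]: "B \<in> sets borel"
  shows "(\<integral>\<^sup>+x. (\<Prod>i\<in>{1..n}. ennreal (f (x i))) * indicator {x. avg x \<in> B \<and> ratio x \<in> A} x * indicator orthant x \<partial>\<mu>)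
       = (\<integral>\<^sup>+u. slice f A u * (indicator B u * radial_weight u) \<partial>lborel)"
proof -
  define H where "H x = (\<Prod>i\<in>{1..n}. ennreal (f (x i))) * (indicator B (avg x) * indicator A (ratio x))" for x
  have "(\<lambda>x. \<Prod>i\<in>{1..n}. ennreal (f (x i))) \<in> borel_measurable \<mu>"
    by (intro borel_measurable_prod_ennreal measurable_compose[OF _ measurable_ennreal]
          measurable_compose[OF _ f] measurable_coord)
  then have H: "H \<in> borel_measurable \<mu>" unfolding H_def by measurable
  have cone: "(\<lambda>i\<in>{1..n}. t * x i) \<in> orthant \<longleftrightarrow> x \<in> orthant" if "x \<in> space \<mu>" "t > 0" for x t
    using that by (auto simp: orthant_def space_mu PiE_iff zero_less_mult_iff)
  have "(\<integral>\<^sup>+x. (\<Prod>i\<in>{1..n}. ennreal (f (x i))) * indicator {x. avg x \<in> B \<and> ratio x \<in> A} x * indicator orthant x \<partial>\<mu>)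
     = (\<integral>\<^sup>+x. H x * indicator orthant x \<partial>\<mu>)"
    by (intro nn_integral_cong) (auto simp: H_def indicator_def)
  also have "\<dots> = (\<integral>\<^sup>+u. (\<integral>\<^sup>+x. H (\<lambda>i\<in>{1..n}. u * x i / avg x) * indicator {x\<in>orthant. avg x < 1} x \<partial>\<mu>)
          * (ennreal (real (card {1..n}) * u ^ (card {1..n} - 1)) * indicator {0<..} u) \<partial>lborel)"
    using n by (intro nn_integral_polar measurable_avg H orthant_sets cone avg_pos avg_scale) auto
  also have "\<dots> = (\<integral>\<^sup>+u. slice f A u * (indicator B u * radial_weight u) \<partial>lborel)"
  proof (rule nn_integral_cong)
    fix u :: real
    show "(\<integral>\<^sup>+x. H (\<lambda>i\<in>{1..n}. u * x i / avg x) * indicator {x\<in>orthant. avg x < 1} x \<partial>\<mu>)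
          * (ennreal (real (card {1..n}) * u ^ (card {1..n} - 1)) * indicator {0<..} u)
        = slice f A u * (indicator B u * radial_weight u)"
    proof (cases "u > 0")
      case False then show ?thesis by (simp add: radial_weight_def)
    next
      case u: True
      have Heq: "H (\<lambda>i\<in>{1..n}. u * x i / avg x) * indicator {x\<in>orthant. avg x < 1} x
        = (\<Prod>i\<in>{1..n}. ennreal (f (u * dir i x))) * indicator {x\<in>base. ratio x \<in> A} x * indicator B u" for x
      proof (cases "x \<in> base")
        case True
        then have a: "avg x > 0" using avg_pos by (auto simp: base_def)
        have eq: "(\<lambda>i\<in>{1..n}. u * x i / avg x) = (\<lambda>i\<in>{1..n}. (u / avg x) * x i)"
          by (auto simp: restrict_def)
        have "avg (\<lambda>i\<in>{1..n}. u * x i / avg x) = u"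
          unfolding eq avg_scale using a by simp
        moreover have "ratio (\<lambda>i\<in>{1..n}. u * x i / avg x) = ratio x"
          unfolding eq using a u by (intro ratio_scale) simp
        moreover have "(\<Prod>i\<in>{1..n}. ennreal (f ((\<lambda>i\<in>{1..n}. u * x i / avg x) i))) = (\<Prod>i\<in>{1..n}. ennreal (f (u * dir i x)))"
          by (intro prod.cong) (auto simp: dir_def)
        moreover have "indicator {x\<in>orthant. avg x < 1} x = (1::ennreal)" using True by (simp add: base_def)
        moreover have "indicator {x\<in>base. ratio x \<in> A} x = (indicator A (ratio x) :: ennreal)"
          using True by (simp add: indicator_def)
        ultimately show ?thesis by (simp only: H_def mult_1_left mult_1_right ac_simps)
      next
        case False then show ?thesis by (auto simp: base_def indicator_def)
      qed
      have "(\<integral>\<^sup>+x. H (\<lambda>i\<in>{1..n}. u * x i / avg x) * indicator {x\<in>orthant. avg x < 1} x \<partial>\<mu>)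
        = slice f A u * indicator B u"
        unfolding Heq by (cases "u \<in> B") (simp_all add: slice_def)
      then show ?thesis by (simp add: radial_weight_def mult.assoc)
    qed
  qed
  finally show ?thesis .
qed

text \<open>The factor \<open>\<kappa>\<close> makes \<open>\<epsilon>\<close> itself bound the distance of the directions from one.\<close>

definition shell :: "real \<Rightarrow> (nat \<Rightarrow> real) set" where
  "shell \<epsilon> = {x\<in>base. ratio x \<in> {..\<kappa> * \<epsilon>}}"

lemma shell_sets [measurable]: "shell \<epsilon> \<in> sets \<mu>"
  unfolding shell_def by (rule base_ratio_sets) simp

text \<open>The range bounds the distance of each coordinate to the mean, and it is small relative to the mean on a shell.\<close>

lemma dir_close:
  assumes x: "x \<in> shell \<epsilon>" and i: "i \<in> {1..n}"
  shows "\<bar>dir i x - 1\<bar> \<le> \<epsilon>"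
proof -
  have a: "avg x > 0" using x avg_pos by (auto simp: shell_def base_def)
  have t: "\<tau> x \<le> \<kappa> * \<epsilon> * avg x"
    using x a by (auto simp: shell_def ratio_def divide_le_eq)
  have "\<bar>x i - x j\<bar> \<le> \<epsilon> * avg x" if "j \<in> {1..n}" for j
    using order_trans[OF tau_ge[OF i that] t] kappa by (simp add: mult.assoc)
  then have "(\<Sum>j=1..n. \<bar>x i - x j\<bar>) \<le> (\<Sum>j=1..n. \<epsilon> * avg x)" by (rule sum_mono)
  then have "(\<Sum>j=1..n. \<bar>x i - x j\<bar>) \<le> n * (\<epsilon> * avg x)" by simp
  then have "\<bar>\<Sum>j=1..n. x i - x j\<bar> \<le> n * (\<epsilon> * avg x)"
    by (rule order_trans[OF sum_abs])
  moreover have "n * (x i - avg x) = (\<Sum>j=1..n. x i - x j)"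
    using n by (simp add: avg_def sum_subtractf field_simps)
  ultimately have "\<bar>n * (x i - avg x)\<bar> \<le> n * (\<epsilon> * avg x)" by simp
  then have "real n * \<bar>x i - avg x\<bar> \<le> n * (\<epsilon> * avg x)" by (simp add: abs_mult)
  then have "\<bar>x i - avg x\<bar> \<le> \<epsilon> * avg x" using n by simp
  moreover have "dir i x - 1 = (x i - avg x) / avg x" using a by (simp add: dir_def diff_divide_distrib)
  ultimately show ?thesis using a by (simp add: divide_le_eq)
qed

lemma emeasure_base_finite: "emeasure \<mu> base < \<infinity>"
proof -
  interpret product_sigma_finite "\<lambda>_. lborel :: real measure" by standard
  have "base \<subseteq> Pi\<^sub>E {1..n} (\<lambda>_. {0..real n})"
  proof
    fix x assume x: "x \<in> base"
    then have pos: "x i > 0" if "i \<in> {1..n}" for i using that by (auto simp: base_def orthant_def PiE_def Pi_def)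
    have "x i \<le> n" if i: "i \<in> {1..n}" for i
    proof -
      have "x i \<le> (\<Sum>i=1..n. x i)" using pos less_imp_le by (intro member_le_sum i) auto
      also have "\<dots> \<le> n" using x n by (simp add: base_def avg_def)
      finally show ?thesis .
    qed
    then show "x \<in> Pi\<^sub>E {1..n} (\<lambda>_. {0..real n})"
      using x less_imp_le[OF pos] by (auto simp: PiE_iff base_def orthant_def)
  qed
  then have "emeasure \<mu> base \<le> emeasure \<mu> (Pi\<^sub>E {1..n} (\<lambda>_. {0..real n}))"
    by (intro emeasure_mono sets_PiM_I_finite) auto
  also have "\<dots> = ennreal (real n) ^ n" by (simp add: emeasure_PiM)
  also have "\<dots> < \<infinity>" by (simp add: ennreal_power)
  finally show ?thesis .
qed

text \<open>A small box next to the constant vector \<open>1/2\<close>, with the first coordinate below \<open>1/2\<close> and all others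
  above it, has positive volume. It lies in the shell, and no vector in it is constant.\<close>

lemma shell_spread:
  assumes \<epsilon>: "\<epsilon> > 0"
  shows "\<not> (AE x in \<mu>. x \<in> shell \<epsilon> \<longrightarrow> dir 1 x = 1)"
proof
  interpret product_sigma_finite "\<lambda>_. lborel :: real measure" by standard
  \<comment> \<open>In the box below the range is at most \<open>2 * \<eta>\<close> and the mean is at least \<open>1/4\<close>, so the ratio is at most \<open>\<kappa> * \<epsilon>\<close>.\<close>
  define \<eta> where "\<eta> = min (1/4) (\<kappa> * \<epsilon> / (8 * (\<Lambda> + 1)))"
  have "\<eta> > 0" using \<epsilon> kappa Lambda by (simp add: \<eta>_def)
  moreover have "\<eta> \<le> 1/4" unfolding \<eta>_def by (rule min.cobounded1)
  ultimately have \<eta>: "\<eta> > 0" "\<eta> \<le> 1/4" by auto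
  have "\<eta> \<le> \<kappa> * \<epsilon> / (8 * (\<Lambda> + 1))" by (simp add: \<eta>_def)
  then have \<eta>': "\<eta> * (8 * (\<Lambda> + 1)) \<le> \<kappa> * \<epsilon>" using Lambda by (simp add: le_divide_eq)
  define S where "S i = (if i = 1 then {1/2 - \<eta><..<1/2} else {1/2<..<1/2 + \<eta>})" for i :: nat
  define box where "box = Pi\<^sub>E {1..n} S"
  have box_sets: "box \<in> sets \<mu>" unfolding box_def S_def by (intro sets_PiM_I_finite) auto
  have "emeasure lborel (S i) = ennreal \<eta>" "S i \<in> sets lborel" for i
    using \<eta> by (simp_all add: S_def)
  then have "emeasure \<mu> box = (\<Prod>i\<in>{1..n}. ennreal \<eta>)"
    unfolding box_def by (simp add: emeasure_PiM)
  then have box_pos: "emeasure \<mu> box \<noteq> 0" using \<eta> by (simp add: ennreal_power)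
  have box_shell: "x \<in> shell \<epsilon> \<and> dir 1 x \<noteq> 1" if x: "x \<in> box" for x
  proof -
    have x1: "1/2 - \<eta> < x 1" "x 1 < 1/2" and xi: "\<And>i. i \<in> {1..n} \<Longrightarrow> i \<noteq> 1 \<Longrightarrow> 1/2 < x i \<and> x i < 1/2 + \<eta>"
      using x n by (force simp: box_def S_def PiE_iff split: if_splits)+
    have rng: "1/2 - \<eta> < x i \<and> x i < 1/2 + \<eta>" if "i \<in> {1..n}" for i
      using x1 xi[OF that] \<eta> by (cases "i = 1") auto
    have orth: "x \<in> orthant"
      using x rng \<eta> by (force simp: box_def orthant_def PiE_iff)
    have n_avg: "(\<Sum>i=1..n. x i) = n * avg x" using n by (simp add: avg_def)
    have "(\<Sum>i=1..n. x i) < (\<Sum>i=1..n. 1/2 + \<eta>)" using rng n by (intro sum_strict_mono) auto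
    then have "n * avg x < n * (1/2 + \<eta>)" unfolding n_avg by simp
    then have a1: "avg x < 1" using n \<eta> by simp
    have "(\<Sum>i=1..n. 1/2 - \<eta>) < (\<Sum>i=1..n. x i)" using rng n by (intro sum_strict_mono) auto
    then have "n * (1/2 - \<eta>) < n * avg x" unfolding n_avg by simp
    then have a2: "avg x > 1/4" using n \<eta> by simp
    have "(\<Sum>i=1..n. x 1) < (\<Sum>i=1..n. x i)"
    proof (rule sum_strict_mono_ex1)
      show "\<forall>i\<in>{1..n}. x 1 \<le> x i" using x1 xi by force
      show "\<exists>i\<in>{1..n}. x 1 < x i" using x1 xi[of 2] n by (intro bexI[of _ 2]) auto
    qed simp
    then have "n * x 1 < n * avg x" unfolding n_avg by simp
    then have "x 1 < avg x" using n by simp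
    then have d: "dir 1 x \<noteq> 1" using a2 by (simp add: dir_def)
    have "\<tau> x \<le> \<Lambda> * ((1/2 + \<eta>) - (1/2 - \<eta>))" using rng \<eta> by (intro tau_le) (auto intro: less_imp_le)
    also have "\<dots> \<le> \<kappa> * \<epsilon> * (1/4)" using \<eta>' \<eta> by (simp add: algebra_simps)
    also have "\<dots> \<le> \<kappa> * \<epsilon> * avg x" using a2 \<epsilon> kappa by (intro mult_left_mono) auto
    finally have "ratio x \<le> \<kappa> * \<epsilon>" using a2 by (simp add: ratio_def divide_le_eq)
    then show ?thesis using d orth a1 by (simp add: shell_def base_def)
  qed
  assume "AE x in \<mu>. x \<in> shell \<epsilon> \<longrightarrow> dir 1 x = 1"
  then have "AE x in \<mu>. x \<notin> box" by eventually_elim (use box_shell in blast)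
  then have "emeasure \<mu> box = 0" using AE_iff_null_sets[OF box_sets] by auto
  with box_pos show False by simp
qed

lemma concentrating_shells:
  "concentrating_measures (\<lambda>\<epsilon>. density \<mu> (indicator (shell \<epsilon>))) dir {1..n}"
proof (rule concentrating_measures.intro)
  fix \<epsilon> :: real assume \<epsilon>: "0 < \<epsilon>"
  have "emeasure (density \<mu> (indicator (shell \<epsilon>))) (space (density \<mu> (indicator (shell \<epsilon>)))) = emeasure \<mu> (shell \<epsilon>)"
    using sets.sets_into_space[OF shell_sets] by (simp add: emeasure_density nn_integral_indicator)
  moreover have "emeasure \<mu> (shell \<epsilon>) \<le> emeasure \<mu> base" by (intro emeasure_mono) (auto simp: shell_def)
  ultimately show "finite_measure (density \<mu> (indicator (shell \<epsilon>)))"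
    using emeasure_base_finite by (intro finite_measureI) (auto simp: top_unique)
  show "AE x in density \<mu> (indicator (shell \<epsilon>)). \<forall>i\<in>{1..n}. \<bar>dir i x - 1\<bar> \<le> \<epsilon>"
    using dir_close by (auto simp: AE_density indicator_def)
  show "AE x in density \<mu> (indicator (shell \<epsilon>)). (\<Sum>i=1..n. dir i x) = card {1..n}"
    using dir_sum by (auto simp: AE_density indicator_def shell_def base_def)
  show "\<not> (AE x in density \<mu> (indicator (shell \<epsilon>)). \<forall>i\<in>{1..n}. dir i x = 1)"
  proof
    assume "AE x in density \<mu> (indicator (shell \<epsilon>)). \<forall>i\<in>{1..n}. dir i x = 1"
    then have "AE x in \<mu>. 0 < (indicator (shell \<epsilon>) x :: ennreal) \<longrightarrow> (\<forall>i\<in>{1..n}. dir i x = 1)"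
      by (subst (asm) AE_density) auto
    then have "AE x in \<mu>. x \<in> shell \<epsilon> \<longrightarrow> dir 1 x = 1" by eventually_elim (use n in auto)
    with shell_spread[OF \<epsilon>] show False by simp
  qed
qed (use measurable_dir in auto)

sublocale concentrating_measures "\<lambda>\<epsilon>. density \<mu> (indicator (shell \<epsilon>))" dir "{1..n}"
  by (rule concentrating_shells)

lemma slice_eq_prod_integral:
  assumes f: "f \<in> borel_measurable borel" "continuous_on {0<..} f"
    and pos: "\<And>x. x > 0 \<Longrightarrow> f x > 0" and nn: "\<And>x. f x \<ge> 0"
    and u: "u > 0" and \<epsilon>: "0 < \<epsilon>" "\<epsilon> \<le> 1/2"
  shows "slice f {..\<kappa> * \<epsilon>} u = ennreal (prod_integral f \<epsilon> u)"
proof -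
  have m: "(\<lambda>x. \<Prod>i\<in>{1..n}. f (u * dir i x)) \<in> borel_measurable \<mu>"
    by (intro borel_measurable_prod measurable_compose[OF _ f(1)] borel_measurable_times borel_measurable_const measurable_dir)
  have "ennreal (prod_integral f \<epsilon> u) = (\<integral>\<^sup>+x. ennreal (\<Prod>i\<in>{1..n}. f (u * dir i x)) \<partial>density \<mu> (indicator (shell \<epsilon>)))"
    unfolding prod_integral_def
    by (intro nn_integral_eq_integral[symmetric] integrable_prod f u \<epsilon> AE_I2 prod_nonneg nn)
  also have "\<dots> = (\<integral>\<^sup>+x. indicator (shell \<epsilon>) x * ennreal (\<Prod>i\<in>{1..n}. f (u * dir i x)) \<partial>\<mu>)"
    using m by (subst nn_integral_density) auto
  also have "\<dots> = slice f {..\<kappa> * \<epsilon>} u"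
    unfolding slice_def shell_def by (intro nn_integral_cong) (simp add: prod_ennreal nn mult.commute)
  finally show ?thesis by simp
qed

end

locale scale_statistic_sample = scale_statistic + prob_space M for M :: "'a measure" +
  fixes X :: "'a \<Rightarrow> nat \<Rightarrow> real" and f :: "real \<Rightarrow> real"
  assumes measurable_X: "X \<in> measurable M (PiM {1..n} (\<lambda>_. lborel))"
    and X_pos: "AE \<omega> in M. X \<omega> \<in> orthant"
    and measurable_f: "f \<in> borel_measurable borel"
    and distr_X: "distr M (PiM {1..n} (\<lambda>_. lborel)) X
        = density (PiM {1..n} (\<lambda>_. lborel)) (\<lambda>x. \<Prod>i\<in>{1..n}. ennreal (f (x i)))"
begin

lemma joint_law:
  assumes A[measurable]: "A \<in> sets borel" and B[measurable]: "B \<in> sets borel"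
  shows "emeasure M {\<omega>\<in>space M. avg (X \<omega>) \<in> B \<and> ratio (X \<omega>) \<in> A}
     = (\<integral>\<^sup>+u. slice f A u * (indicator B u * radial_weight u) \<partial>lborel)"
proof -
  note [measurable] = measurable_X
  define T where "T = {x\<in>space \<mu>. avg x \<in> B \<and> ratio x \<in> A} \<inter> orthant"
  have T: "T \<in> sets \<mu>" unfolding T_def by measurable
  have Phi: "(\<lambda>x. \<Prod>i\<in>{1..n}. ennreal (f (x i))) \<in> borel_measurable \<mu>"
    by (intro borel_measurable_prod_ennreal measurable_compose[OF _ measurable_ennreal]
          measurable_compose[OF _ measurable_f] measurable_coord)
  have "emeasure M {\<omega>\<in>space M. avg (X \<omega>) \<in> B \<and> ratio (X \<omega>) \<in> A} = emeasure M (X -` T \<inter> space M)"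
  proof (rule emeasure_eq_AE)
    show "AE \<omega> in M. \<omega> \<in> {\<omega>\<in>space M. avg (X \<omega>) \<in> B \<and> ratio (X \<omega>) \<in> A} \<longleftrightarrow> \<omega> \<in> X -` T \<inter> space M"
      using X_pos by eventually_elim (auto simp: T_def orthant_space)
    show "{\<omega>\<in>space M. avg (X \<omega>) \<in> B \<and> ratio (X \<omega>) \<in> A} \<in> sets M" by measurable
    show "X -` T \<inter> space M \<in> sets M" using T by (rule measurable_sets[OF measurable_X])
  qed
  also have "\<dots> = emeasure (distr M \<mu> X) T" using T measurable_X by (simp add: emeasure_distr)
  also have "\<dots> = (\<integral>\<^sup>+x. (\<Prod>i\<in>{1..n}. ennreal (f (x i))) * indicator T x \<partial>\<mu>)"
    unfolding distr_X by (rule emeasure_density[OF Phi T])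
  also have "\<dots> = (\<integral>\<^sup>+x. (\<Prod>i\<in>{1..n}. ennreal (f (x i))) * indicator {x. avg x \<in> B \<and> ratio x \<in> A} x * indicator orthant x \<partial>\<mu>)"
    by (intro nn_integral_cong) (simp add: T_def indicator_def)
  also have "\<dots> = (\<integral>\<^sup>+u. slice f A u * (indicator B u * radial_weight u) \<partial>lborel)"
    by (rule polar_slices[OF measurable_f A B])
  finally show ?thesis .
qed

lemma measurable_avg_X: "(\<lambda>\<omega>. avg (X \<omega>)) \<in> borel_measurable M"
  and measurable_ratio_X: "(\<lambda>\<omega>. ratio (X \<omega>)) \<in> borel_measurable M"
  using measurable_compose[OF measurable_X] measurable_avg measurable_ratio by blast+

text \<open>For such \<open>f\<close> the product \<open>\<Prod>i. f (u * dir i x)\<close> splits into a function of \<open>u\<close> and one of the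
  direction: the powers are multiplicative, and the exponents of the exponentials add up to
  \<open>\<beta> * n * u\<close> because the directions have mean one. So the joint law is a product.\<close>

lemma indep_if_powr_exp:
  assumes f: "\<And>x. x > 0 \<Longrightarrow> f x = C * x powr k * exp (\<beta> * x)" and C: "C \<ge> 0"
  shows "indep_var borel (\<lambda>\<omega>. avg (X \<omega>)) borel (\<lambda>\<omega>. ratio (X \<omega>))"
proof -
  define h where "h u = ennreal (u powr (k * n) * exp (\<beta> * n * u))" for u :: real
  define q where "q A = slice (\<lambda>x. C * x powr k) A 1" for A
  have slice: "slice f A u = h u * q A" if "u > 0" "A \<in> sets borel" for u A
  proof -
    have "(\<Prod>i\<in>{1..n}. ennreal (f (u * dir i x))) * indicator {x\<in>base. ratio x \<in> A} x
      = h u * ((\<Prod>i\<in>{1..n}. ennreal (C * (1 * dir i x) powr k)) * indicator {x\<in>base. ratio x \<in> A} x)" for x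
    proof (cases "x \<in> base")
      case True
      then have x: "x \<in> orthant" by (simp add: base_def)
      have "f (u * dir i x) = (u powr k * exp (\<beta> * u * dir i x)) * (C * (1 * dir i x) powr k)" if "i \<in> {1..n}" for i
        using \<open>u > 0\<close> dir_pos[OF x that] by (subst f) (auto simp: powr_mult mult.assoc)
      then have "(\<Prod>i\<in>{1..n}. f (u * dir i x))
        = (\<Prod>i\<in>{1..n}. u powr k * exp (\<beta> * u * dir i x)) * (\<Prod>i\<in>{1..n}. C * (1 * dir i x) powr k)"
        by (simp only: prod.distrib[symmetric] cong: prod.cong)
      also have "(\<Prod>i\<in>{1..n}. u powr k * exp (\<beta> * u * dir i x)) = u powr (k * n) * exp (\<beta> * u * (\<Sum>i=1..n. dir i x))"
        using \<open>u > 0\<close> by (simp add: prod.distrib exp_sum sum_distrib_left powr_powr[symmetric] powr_realpow)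
      also have "\<beta> * u * (\<Sum>i=1..n. dir i x) = \<beta> * n * u" by (simp add: dir_sum[OF x])
      finally have eq: "(\<Prod>i\<in>{1..n}. f (u * dir i x)) = (u powr (k * n) * exp (\<beta> * n * u)) * (\<Prod>i\<in>{1..n}. C * (1 * dir i x) powr k)" .
      have "f (u * dir i x) \<ge> 0" if "i \<in> {1..n}" for i
        using \<open>u > 0\<close> dir_pos[OF x that] C by (subst f) auto
      then have "(\<Prod>i\<in>{1..n}. ennreal (f (u * dir i x))) = ennreal (\<Prod>i\<in>{1..n}. f (u * dir i x))"
        by (rule prod_ennreal)
      moreover have "(\<Prod>i\<in>{1..n}. ennreal (C * (1 * dir i x) powr k)) = ennreal (\<Prod>i\<in>{1..n}. C * (1 * dir i x) powr k)"
        using C by (intro prod_ennreal) auto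
      moreover have "(\<Prod>i\<in>{1..n}. C * (1 * dir i x) powr k) \<ge> 0" using C by (intro prod_nonneg) auto
      ultimately have "(\<Prod>i\<in>{1..n}. ennreal (f (u * dir i x))) = h u * (\<Prod>i\<in>{1..n}. ennreal (C * (1 * dir i x) powr k))"
        unfolding h_def eq by (simp add: ennreal_mult)
      then show ?thesis by (simp only: mult.assoc)
    qed simp
    moreover have "(\<lambda>x. (\<Prod>i\<in>{1..n}. ennreal (C * (1 * dir i x) powr k)) * indicator {x\<in>base. ratio x \<in> A} x) \<in> borel_measurable \<mu>"
    proof -
      have "(\<lambda>x. ennreal (C * (1 * dir i x) powr k)) \<in> borel_measurable \<mu>" if "i \<in> {1..n}" for i
        using measurable_dir[OF that] by measurable
      then have "(\<lambda>x. (\<Prod>i\<in>{1..n}. ennreal (C * (1 * dir i x) powr k))) \<in> borel_measurable \<mu>"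
        by (rule borel_measurable_prod_ennreal)
      moreover note [measurable] = base_ratio_sets[OF that(2)]
      ultimately show ?thesis by measurable
    qed
    ultimately show ?thesis unfolding slice_def q_def by (simp add: nn_integral_cmult)
  qed
  show ?thesis
  proof (rule indep_var_if_emeasure_product[OF measurable_avg_X measurable_ratio_X])
    fix A B :: "real set" assume A: "A \<in> sets borel" and [measurable]: "B \<in> sets borel"
    have "slice f A u * (indicator B u * radial_weight u) = (h u * (indicator B u * radial_weight u)) * q A" for u
      by (cases "u > 0") (simp_all add: slice[OF _ A] radial_weight_def ac_simps)
    then show "emeasure M {\<omega>\<in>space M. avg (X \<omega>) \<in> B \<and> ratio (X \<omega>) \<in> A}
      = (\<integral>\<^sup>+u. h u * (indicator B u * radial_weight u) \<partial>lborel) * q A"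
      unfolding joint_law[OF A \<open>B \<in> sets borel\<close>]
      by (simp add: nn_integral_multc h_def)
  qed
qed

text \<open>Independence makes the densities of the mean, restricted to the events that the ratio is at most
  \<open>\<kappa> * \<epsilon>\<close>, multiples of the unrestricted density, hence pairwise proportional. They are continuous, so
  this holds at every point and not only almost everywhere.\<close>

lemma powr_exp_if_indep:
  assumes indep: "indep_var borel (\<lambda>\<omega>. avg (X \<omega>)) borel (\<lambda>\<omega>. ratio (X \<omega>))"
    and cont: "continuous_on {0<..} f" and pos: "\<And>x. x > 0 \<Longrightarrow> f x > 0" and nn: "\<And>x. f x \<ge> 0"
  obtains k C \<beta> where "C > 0" "\<And>s. s > 0 \<Longrightarrow> f s = C * s powr k * exp (\<beta> * s)"
proof -
  note [measurable] = measurable_avg_X measurable_ratio_X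
  define c where "c \<epsilon> = prob {\<omega>\<in>space M. ratio (X \<omega>) \<le> \<kappa> * \<epsilon>}" for \<epsilon>
  have AE_c: "AE u in lborel. u > 0 \<longrightarrow> ennreal (prod_integral f \<epsilon> u) = ennreal (c \<epsilon>) * slice f UNIV u"
    if \<epsilon>: "0 < \<epsilon>" "\<epsilon> \<le> 1/2" for \<epsilon>
  proof -
    define A where "A = {..\<kappa> * \<epsilon>}"
    have A: "A \<in> sets borel" and U: "UNIV \<in> sets (borel :: real measure)" by (simp_all add: A_def)
    define g g1 where "g = slice f A" and "g1 = slice f UNIV"
    have [measurable]: "g \<in> borel_measurable borel" "g1 \<in> borel_measurable borel"
      unfolding g_def g1_def by (rule measurable_slice[OF measurable_f]; simp add: A)+
    have "density lborel (\<lambda>u. g u * radial_weight u) = density lborel (\<lambda>u. ennreal (c \<epsilon>) * (g1 u * radial_weight u))"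
    proof (rule measure_eqI)
      fix B assume "B \<in> sets (density lborel (\<lambda>u. g u * radial_weight u))"
      then have B[measurable]: "B \<in> sets borel" by simp
      have "emeasure M {\<omega>\<in>space M. avg (X \<omega>) \<in> B \<and> ratio (X \<omega>) \<in> A}
          = ennreal (c \<epsilon>) * emeasure M {\<omega>\<in>space M. avg (X \<omega>) \<in> B \<and> ratio (X \<omega>) \<in> UNIV}"
        using indep_varD[OF indep B A]
        by (simp add: emeasure_eq_measure A_def c_def vimage_def Int_def conj_commute ennreal_mult[symmetric] mult.commute)
      then have eq: "(\<integral>\<^sup>+u. g u * (indicator B u * radial_weight u) \<partial>lborel)
          = ennreal (c \<epsilon>) * (\<integral>\<^sup>+u. g1 u * (indicator B u * radial_weight u) \<partial>lborel)"
        unfolding joint_law[OF A B] joint_law[OF U B] g_def g1_def .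
      have "emeasure (density lborel (\<lambda>u. g u * radial_weight u)) B
          = (\<integral>\<^sup>+u. g u * radial_weight u * indicator B u \<partial>lborel)"
        by (rule emeasure_density) simp_all
      also have "\<dots> = (\<integral>\<^sup>+u. g u * (indicator B u * radial_weight u) \<partial>lborel)"
        by (simp only: ac_simps)
      also have "\<dots> = (\<integral>\<^sup>+u. ennreal (c \<epsilon>) * (g1 u * (indicator B u * radial_weight u)) \<partial>lborel)"
        unfolding eq by (rule nn_integral_cmult[symmetric]) measurable
      also have "\<dots> = (\<integral>\<^sup>+u. ennreal (c \<epsilon>) * (g1 u * radial_weight u) * indicator B u \<partial>lborel)"
        by (simp only: ac_simps)
      also have "\<dots> = emeasure (density lborel (\<lambda>u. ennreal (c \<epsilon>) * (g1 u * radial_weight u))) B"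
        by (rule emeasure_density[symmetric]) simp_all
      finally show "emeasure (density lborel (\<lambda>u. g u * radial_weight u)) B
          = emeasure (density lborel (\<lambda>u. ennreal (c \<epsilon>) * (g1 u * radial_weight u))) B" .
    qed simp
    then have "AE u in lborel. g u * radial_weight u = ennreal (c \<epsilon>) * (g1 u * radial_weight u)"
      by (rule sigma_finite_measure.density_unique[OF sigma_finite_lborel, rotated 2]) simp_all
    then show ?thesis
    proof eventually_elim
      case (elim u)
      show ?case
      proof
        assume u: "u > 0"
        have "radial_weight u \<noteq> 0" "radial_weight u \<noteq> \<top>" using u n by (simp_all add: radial_weight_def)
        then have "g u = ennreal (c \<epsilon>) * g1 u"
          using elim ennreal_mult_cancel_left[of "radial_weight u" "g u" "ennreal (c \<epsilon>) * g1 u"]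
          by (simp add: ac_simps)
        then show "ennreal (prod_integral f \<epsilon> u) = ennreal (c \<epsilon>) * slice f UNIV u"
          using slice_eq_prod_integral[OF measurable_f cont pos nn u \<epsilon>] by (simp add: g_def g1_def A_def)
      qed
    qed
  qed
  have J_pos: "prod_integral f \<epsilon> u > 0" if "0 < u" "0 < \<epsilon>" "\<epsilon> \<le> 1/2" for u \<epsilon>
    using prod_integral_pos[OF measurable_f cont pos that] .
  have c_pos: "c \<epsilon> > 0" if \<epsilon>: "0 < \<epsilon>" "\<epsilon> \<le> 1/2" for \<epsilon>
  proof (rule ccontr)
    assume "\<not> c \<epsilon> > 0"
    then have c0: "c \<epsilon> = 0" by (simp add: c_def zero_less_measure_iff)
    have "AE u in lborel. u > 0 \<longrightarrow> prod_integral f \<epsilon> u = 0"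
      using AE_c[OF \<epsilon>] by eventually_elim (use c0 J_pos[OF _ \<epsilon>] in \<open>auto simp: ennreal_eq_0_iff intro!: antisym less_imp_le\<close>)
    then have "prod_integral f \<epsilon> 1 = 0"
      by (intro eq_if_AE_eq_continuous[of _ "\<lambda>_. 0"] continuous_prod_integral[OF measurable_f cont \<epsilon>]) auto
    with J_pos[OF _ \<epsilon>, of 1] show False by simp
  qed
  have ratio_const: "c \<epsilon>' * prod_integral f \<epsilon> s = c \<epsilon> * prod_integral f \<epsilon>' s"
    if \<epsilon>: "0 < \<epsilon>" "\<epsilon> \<le> 1/2" and \<epsilon>': "0 < \<epsilon>'" "\<epsilon>' \<le> 1/2" and s: "0 < s" for \<epsilon> \<epsilon>' s
  proof (rule eq_if_AE_eq_continuous[OF _ _ _ s])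
    show "AE u in lborel. u > 0 \<longrightarrow> c \<epsilon>' * prod_integral f \<epsilon> u = c \<epsilon> * prod_integral f \<epsilon>' u"
      using AE_c[OF \<epsilon>] AE_c[OF \<epsilon>']
    proof eventually_elim
      case (elim u)
      show ?case
      proof
        assume u: "u > 0"
        have "ennreal (c \<epsilon>') * ennreal (prod_integral f \<epsilon> u) = ennreal (c \<epsilon>) * ennreal (prod_integral f \<epsilon>' u)"
          using elim u by (simp add: ac_simps)
        then show "c \<epsilon>' * prod_integral f \<epsilon> u = c \<epsilon> * prod_integral f \<epsilon>' u"
          using c_pos[OF \<epsilon>] c_pos[OF \<epsilon>'] J_pos[OF u \<epsilon>] J_pos[OF u \<epsilon>']
          by (simp add: ennreal_mult[symmetric])
      qed
    qed
  qed (intro continuous_intros continuous_prod_integral[OF measurable_f cont] \<epsilon> \<epsilon>')+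
  have cross: "prod_integral f \<epsilon> s * prod_integral f \<epsilon>' t = prod_integral f \<epsilon> t * prod_integral f \<epsilon>' s"
    if \<epsilon>: "0 < \<epsilon>" "\<epsilon> \<le> 1/2" and \<epsilon>': "0 < \<epsilon>'" "\<epsilon>' \<le> 1/2" and st: "0 < s" "0 < t" for \<epsilon> \<epsilon>' s t
  proof -
    have "(c \<epsilon>' * prod_integral f \<epsilon> s) * (c \<epsilon> * prod_integral f \<epsilon>' t)
        = (c \<epsilon> * prod_integral f \<epsilon>' s) * (c \<epsilon>' * prod_integral f \<epsilon> t)"
      unfolding ratio_const[OF \<epsilon> \<epsilon>' st(1)] ratio_const[OF \<epsilon> \<epsilon>' st(2)] ..
    then have "(c \<epsilon> * c \<epsilon>') * (prod_integral f \<epsilon> s * prod_integral f \<epsilon>' t)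
        = (c \<epsilon> * c \<epsilon>') * (prod_integral f \<epsilon> t * prod_integral f \<epsilon>' s)"
      by (simp only: ac_simps)
    then show ?thesis using c_pos[OF \<epsilon>] c_pos[OF \<epsilon>'] by simp
  qed
  note result = that
  show thesis
  proof (rule powr_exp_if_proportional[OF measurable_f cont])
    show "0 < f x" if "0 < x" for x by (rule pos[OF that])
    show "prod_integral f \<epsilon> s * prod_integral f \<epsilon>' t = prod_integral f \<epsilon> t * prod_integral f \<epsilon>' s"
      if "0 < \<epsilon>" "\<epsilon> \<le> 1/2" "0 < \<epsilon>'" "\<epsilon>' \<le> 1/2" "0 < s" "0 < t" for \<epsilon> \<epsilon>' s t
      by (rule cross[OF that])
    show thesis if "C > 0" "\<And>s. s > 0 \<Longrightarrow> f s = C * s powr k * exp (\<beta> * s)" for k C \<beta>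
      by (rule result[OF that])
  qed
qed

end

section \<open>The characterization of the gamma distribution\<close>

theorem corollary4:
  fixes M :: "'a measure"
    and X :: "nat \<Rightarrow> 'a \<Rightarrow> real"
    and F :: "real measure"
    and f :: "real \<Rightarrow> real"
    and a :: "nat \<Rightarrow> nat \<Rightarrow> real"
    and p :: real
    and n :: nat
  assumes "prob_space M"
    and "n \<ge> 3"
    and "prob_space.indep_vars M (\<lambda>_. borel) X {1..n}"
    and "\<And>i. i \<in> {1..n} \<Longrightarrow> distr M borel (X i) = F"
    and "\<And>i. i \<in> {1..n} \<Longrightarrow> AE \<omega> in M. X i \<omega> > 0"
    and "f \<in> borel_measurable borel"
    and "\<And>x. f x \<ge> 0"
    and "F = density lborel (\<lambda>x. ennreal (f x))"
    and "\<And>x. x > 0 \<Longrightarrow> f x > 0"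
    and "continuous_on {0<..} f"
    and "p > 0"
    and "\<And>i j. i \<in> {1..n} \<Longrightarrow> j \<in> {1..n} \<Longrightarrow> a i j \<ge> 0"
    and "a 1 n + a n 1 > 0"
  shows "prob_space.indep_var M
           borel (sample_mean n X)
           borel (\<lambda>\<omega>. spacing_statistic n a p X \<omega> powr (1 / p) / sample_mean n X \<omega>)
         \<longleftrightarrow> gamma_distribution F"
proof -
  interpret prob_space M by fact
  define \<tau> where "\<tau> = spacing_root n a p"
  define X' where "X' = (\<lambda>\<omega>. \<lambda>i\<in>{1..n}. X i \<omega>)"
  interpret scale_statistic n \<tau> "(a 1 n + a n 1) powr (1 / p)" "(\<Sum>i=1..n. \<Sum>j=1..n. a i j) powr (1 / p)"
  proof
    show "2 \<le> n" using assms(2) by simp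
    show "\<tau> \<in> borel_measurable (PiM {1..n} (\<lambda>_. lborel))"
      unfolding \<tau>_def by (rule measurable_spacing_root)
    show "\<tau> (\<lambda>i\<in>{1..n}. c * x i) = c * \<tau> x" if "0 < c" for c x
      unfolding \<tau>_def by (rule spacing_root_scale[OF that assms(11,12)])
    show "(a 1 n + a n 1) powr (1 / p) * \<bar>x i - x j\<bar> \<le> \<tau> x" if "i \<in> {1..n}" "j \<in> {1..n}" for i j x
      unfolding \<tau>_def by (rule spacing_root_ge[OF _ assms(11,12) that]) (use assms(2) in auto)
    show "\<tau> x \<le> (\<Sum>i=1..n. \<Sum>j=1..n. a i j) powr (1 / p) * (v - u)"
      if "u \<le> v" "\<And>i. i \<in> {1..n} \<Longrightarrow> u \<le> x i \<and> x i \<le> v" for u v x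
      unfolding \<tau>_def by (rule spacing_root_le[OF assms(11,12) that])
  qed (use assms(13) in auto)
  have rv: "X i \<in> borel_measurable M" if "i \<in> {1..n}" for i
    using assms(3) that unfolding indep_vars_def by auto
  have X': "X' \<in> measurable M \<mu>"
    unfolding X'_def by (rule measurable_restrict_PiM_lborel[OF rv])
  have F_prob: "prob_space F"
    using prob_space_distr[OF rv[of 1]] assms(2) assms(4)[of 1] by auto
  have X'_pos: "AE \<omega> in M. X' \<omega> \<in> orthant"
  proof -
    have "AE \<omega> in M. \<forall>i\<in>{1..n}. X i \<omega> > 0"
      using assms(5) by (intro AE_finite_allI) auto
    then show ?thesis by eventually_elim (auto simp: orthant_def X'_def)
  qed
  have F_pos: "AE x in F. x > 0"
  proof -
    have one: "1 \<in> {1..n}" using assms(2) by simp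
    show ?thesis
      unfolding assms(4)[OF one, symmetric] using assms(5)[OF one] rv[OF one]
      by (subst AE_distr_iff) auto
  qed
  have distr_X': "distr M \<mu> X' = density \<mu> (\<lambda>x. \<Prod>i\<in>{1..n}. ennreal (g (x i)))"
    if g: "g \<in> borel_measurable borel" "F = density lborel (\<lambda>x. ennreal (g x))" for g
  proof -
    have "distr M \<mu> X' = distr M (PiM {1..n} (\<lambda>_. borel)) X'"
      by (intro distr_cong refl sets_PiM_cong) simp
    also have "\<dots> = PiM {1..n} (\<lambda>i. distr M borel (X i))"
      unfolding X'_def using assms(2,3) rv by (subst indep_vars_iff_distr_eq_PiM'[symmetric]) auto
    also have "\<dots> = PiM {1..n} (\<lambda>_. F)" using assms(4) by (intro PiM_cong) auto
    also have "\<dots> = density \<mu> (\<lambda>x. \<Prod>i\<in>{1..n}. ennreal (g (x i)))"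
      unfolding g(2) using g(1) F_prob[unfolded g(2)]
      by (intro PiM_density) (auto intro: prob_space_imp_sigma_finite)
    finally show ?thesis .
  qed
  have mean_eq: "sample_mean n X = (\<lambda>\<omega>. avg (X' \<omega>))"
    by (auto simp: sample_mean_def avg_def X'_def fun_eq_iff)
  have ratio_eq: "(\<lambda>\<omega>. spacing_statistic n a p X \<omega> powr (1 / p) / sample_mean n X \<omega>) = (\<lambda>\<omega>. ratio (X' \<omega>))"
    by (simp only: mean_eq ratio_def spacing_statistic_eq X'_def \<tau>_def[symmetric])
  show ?thesis unfolding ratio_eq unfolding mean_eq
  proof
    assume indep: "indep_var borel (\<lambda>\<omega>. avg (X' \<omega>)) borel (\<lambda>\<omega>. ratio (X' \<omega>))"
    interpret scale_statistic_sample n \<tau> "(a 1 n + a n 1) powr (1 / p)"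
      "(\<Sum>i=1..n. \<Sum>j=1..n. a i j) powr (1 / p)" M X' f
      by unfold_locales (use X' X'_pos assms(6) distr_X'[OF assms(6,8)] in auto)
    show "gamma_distribution F"
    proof (rule powr_exp_if_indep[OF indep assms(10)])
      show "0 < f x" if "0 < x" for x by (rule assms(9)[OF that])
      show "0 \<le> f x" for x by (rule assms(7))
      show "gamma_distribution F" if "C > 0" "\<And>s. s > 0 \<Longrightarrow> f s = C * s powr k * exp (\<beta> * s)" for k C \<beta>
        by (rule gamma_distribution_if_powr_exp[OF assms(8) F_prob assms(6,7) F_pos that])
    qed
  next
    assume "gamma_distribution F"
    then obtain \<alpha> b where ab: "\<alpha> > 0" "b > 0" and F: "F = density lborel (\<lambda>x. ennreal (gamma_density \<alpha> b x))"
      unfolding gamma_distribution_def by blast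
    have g: "gamma_density \<alpha> b \<in> borel_measurable borel" unfolding gamma_density_def by measurable
    interpret scale_statistic_sample n \<tau> "(a 1 n + a n 1) powr (1 / p)"
      "(\<Sum>i=1..n. \<Sum>j=1..n. a i j) powr (1 / p)" M X' "gamma_density \<alpha> b"
      by unfold_locales (use X' X'_pos g distr_X'[OF g F] in auto)
    show "indep_var borel (\<lambda>\<omega>. avg (X' \<omega>)) borel (\<lambda>\<omega>. ratio (X' \<omega>))"
    proof (rule indep_if_powr_exp)
      show "gamma_density \<alpha> b x = 1 / (Gamma \<alpha> * b powr \<alpha>) * x powr (\<alpha> - 1) * exp ((- 1 / b) * x)" if "x > 0" for x
        using that by (simp add: gamma_density_def)
      show "1 / (Gamma \<alpha> * b powr \<alpha>) \<ge> 0" using ab by (simp add: Gamma_real_nonneg)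
    qed
  qed
qed

end
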